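(* Fix $\beta>0$ and $x_0\in[0,1]$, and let $R>0$ and $C>0$. Consider the Gaussian white noise model $$dY_x = f(x)\,dx+\frac{1}{\sqrt n}\,dW_x,\qquad x\in[0,1],$$ with parameter space $\mathscr{C}^\beta(R)$ for the regression function $f$. (i) There exist positive constants $c=c(C,R)$ and $N=N(C,R)$ (for the fixed smoothness index $\beta$, not depending on the estimator or on $n$) such that for all $n\ge N$ the following holds: if $\widehat f(x_0)$ is an estimator for $f(x_0)$ satisfying $$\sup_{f\in\mathscr{C}^\beta(R)}\big|\operatorname{Bias}_f(\widehat f(x_0))\big|<\Big(\frac Cn\Big)^{\beta/(2\beta+1)},$$ then $$\sup_{f\in\mathscr{C}^\beta(R)}E_f\Big[\big|\widehat f(x_0)-E_f[\widehat f(x_0)]\big|\Big]\ \ge\ c\,n^{-\beta/(2\beta+1)}.$$ (ii) The same holds with the mean replaced by the median: there exist positive constants $c=c(C,R)$ and $N=N(C,R)$ such that for all $n\ge N$, if $\widehat f(x_0)$ is an estimator satisfying $$\sup_{f\in\mathscr{C}^\beta(R)}\big|\operatorname{Med}_f[\widehat f(x_0)]-f(x_0)\big|<\Big(\frac Cn\Big)^{\beta/(2\beta+1)},$$ then $$\sup_{f\in\mathscr{C}^\beta(R)}E_f\Big[\big|\widehat f(x_0)-\operatorname{Med}_f[\widehat f(x_0)]\big|\Big]\ \ge\ c\,n^{-\beta/(2\beta+1)}.$$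
   Context: Gaussian white noise model: one observes a random function $Y=(Y_x)_{x\in[0,1]}$ with $dY_x=f(x)\,dx+n^{-1/2}\,dW_x$, where $W$ is an unobserved standard Brownian motion on $[0,1]$, $f\in L^2([0,1])$ is the unknown real-valued regression function and $n$ is a positive integer. $P_f$ denotes the distribution of the data $Y$ when the regression function is $f$, and $E_f$ denotes expectation under $P_f$. An estimator $\widehat f(x_0)$ is any real-valued measurable function of the data $Y$ (it may depend on $n$). $\operatorname{Bias}_f(\widehat f(x_0))$ is the difference between $E_f[\widehat f(x_0)]$ and $f(x_0)$ (only its absolute value is used); when means and biases are used, $\widehat f(x_0)$ is understood to be integrable under $P_f$ for every $f\in\mathscr{C}^\beta(R)$. $\operatorname{Med}_f[\widehat f(x_0)]$ denotes the median of $\widehat f(x_0)$ under $P_f$. Hölder classes: for $\beta>0$ let $\lfloor\beta\rfloor$ denote the largest integer that is strictly smaller than $\beta$. For a domain $D\subseteq\mathbb{R}$ define $$\|f\|_{\mathscr{C}^\beta(D)}=\sum_{\ell\le\lfloor\beta\rfloor}\|f^{(\ell)}\|_{L^\infty(D)}+\sup_{x,y\in D,\,x\ne y}\frac{|f^{(\lfloor\beta\rfloor)}(x)-f^{(\lfloor\beta\rfloor)}(y)|}{|x-y|^{\beta-\lfloor\beta\rfloor}},$$ where the sum is over integers $0\le\ell\le\lfloor\beta\rfloor$, $\|\cdot\|_{L^\infty(D)}$ is the supremum norm on $D$ and $f^{(\ell)}$ is the $\ell$-th (strong) derivative of $f$. Then $\mathscr{C}^\beta(R):=\{f:[0,1]\to\mathbb{R}:\|f\|_{\mathscr{C}^\beta([0,1])}\le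 R\}$. *)

theory Defs
  imports "HOL-Probability.Probability"
begin

section \<open>Hoelder balls\<close>

text \<open>The largest integer strictly smaller than \<open>\<beta>\<close>; this differs from the library's floor when
  \<open>\<beta>\<close> is an integer. For \<open>\<beta> > 0\<close> it is nonnegative, so it may be searched for among the naturals.\<close>

definition strict_floor :: "real \<Rightarrow> nat" where
  "strict_floor \<beta> = (GREATEST k::nat. real k < \<beta>)"

text \<open>A function on \<open>D\<close> is represented by a total function; derivatives are taken within \<open>D\<close>
  (one-sided at the end points of an interval), so only the values on \<open>D\<close> matter.\<close>

definition deriv_within :: "real set \<Rightarrow> nat \<Rightarrow> (real \<Rightarrow> real) \<Rightarrow> real \<Rightarrow> real" where
  "deriv_within D l f = ((\<lambda>g x. vector_derivative g (at x within D)) ^^ l) f"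

text \<open>All suprema are taken in \<open>ennreal\<close>, so unbounded quantities have norm \<open>\<infinity>\<close> and suprema over
  the empty set are \<open>0\<close>. The value is meaningful only for functions that are
  \<open>strict_floor \<beta>\<close> times differentiable on \<open>D\<close>.\<close>

definition holder_norm :: "real \<Rightarrow> real set \<Rightarrow> (real \<Rightarrow> real) \<Rightarrow> ennreal" where
  "holder_norm \<beta> D f =
     (\<Sum>l\<le>strict_floor \<beta>. SUP x\<in>D. ennreal \<bar>deriv_within D l f x\<bar>) +
     (SUP (x, y)\<in>{(x, y). x \<in> D \<and> y \<in> D \<and> x \<noteq> y}.
        ennreal (\<bar>deriv_within D (strict_floor \<beta>) f x - deriv_within D (strict_floor \<beta>) f y\<bar>
                 / \<bar>x - y\<bar> powr (\<beta> - real (strict_floor \<beta>))))"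

definition holder_ball :: "real \<Rightarrow> real \<Rightarrow> (real \<Rightarrow> real) set" where
  "holder_ball \<beta> R =
     {f. (\<forall>l<strict_floor \<beta>. deriv_within {0..1} l f differentiable_on {0..1}) \<and>
         holder_norm \<beta> {0..1} f \<le> ennreal R}"

section \<open>The Gaussian white noise model\<close>

definition standard_brownian_motion :: "'w measure \<Rightarrow> (real \<Rightarrow> 'w \<Rightarrow> real) \<Rightarrow> bool" where
  "standard_brownian_motion M W \<longleftrightarrow>
     prob_space M \<and>
     (\<forall>t\<in>{0..1}. W t \<in> borel_measurable M) \<and>
     (\<forall>\<omega>\<in>space M. W 0 \<omega> = 0) \<and>
     (\<forall>\<omega>\<in>space M. continuous_on {0..1} (\<lambda>t. W t \<omega>)) \<and>
     (\<forall>s t. 0 \<le> s \<and> s < t \<and> t \<le> 1 \<longrightarrow>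
        distributed M lborel (\<lambda>\<omega>. W t \<omega> - W s \<omega>) (normal_density 0 (sqrt (t - s)))) \<and>
     (\<forall>(k::nat) t. 0 \<le> t 0 \<and> (\<forall>i<k. t i \<le> t (Suc i)) \<and> t k \<le> 1 \<longrightarrow>
        prob_space.indep_vars M (\<lambda>_. borel) (\<lambda>i \<omega>. W (t (Suc i)) \<omega> - W (t i) \<omega>) {..<k})"

text \<open>The sample space is the set of continuous functions on \<open>[0,1]\<close> with the \<open>\<sigma>\<close>-algebra generated
  by the evaluations, which is the Borel \<open>\<sigma>\<close>-algebra of the uniform norm.\<close>

definition path_space :: "(real \<Rightarrow> real) measure" where
  "path_space = restrict_space (\<Pi>\<^sub>M x\<in>{0..1}. borel) {y. continuous_on {0..1} y}"

text \<open>The stochastic differential equation is read in integrated form with \<open>Y\<^sub>0 = 0\<close>.\<close>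

definition observation ::
    "(real \<Rightarrow> 'w \<Rightarrow> real) \<Rightarrow> nat \<Rightarrow> (real \<Rightarrow> real) \<Rightarrow> 'w \<Rightarrow> real \<Rightarrow> real" where
  "observation W n f \<omega> = (\<lambda>x\<in>{0..1}. (LBINT t:{0..x}. f t) + W x \<omega> / sqrt (real n))"

definition data_law ::
    "'w measure \<Rightarrow> (real \<Rightarrow> 'w \<Rightarrow> real) \<Rightarrow> nat \<Rightarrow> (real \<Rightarrow> real) \<Rightarrow> (real \<Rightarrow> real) measure" where
  "data_law M W n f = distr M path_space (observation W n f)"

section \<open>Mean, median and mean absolute deviation of an estimator\<close>

abbreviation estimator :: "((real \<Rightarrow> real) \<Rightarrow> real) \<Rightarrow> bool" where
  "estimator T \<equiv> T \<in> borel_measurable path_space"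

text \<open>Medians need not be unique, hence a predicate instead of a function.\<close>

definition is_median :: "'a measure \<Rightarrow> ('a \<Rightarrow> real) \<Rightarrow> real \<Rightarrow> bool" where
  "is_median P T m \<longleftrightarrow>
     measure P {y \<in> space P. T y \<le> m} \<ge> 1/2 \<and> measure P {y \<in> space P. T y \<ge> m} \<ge> 1/2"

definition bias :: "'a measure \<Rightarrow> ('a \<Rightarrow> real) \<Rightarrow> real \<Rightarrow> real" where
  "bias P T \<theta> = integral\<^sup>L P T - \<theta>"

definition mean_abs_dev :: "'a measure \<Rightarrow> ('a \<Rightarrow> real) \<Rightarrow> real \<Rightarrow> ennreal" where
  "mean_abs_dev P T a = (\<integral>\<^sup>+ y. ennreal \<bar>T y - a\<bar> \<partial>P)"

end

theory Submission
  imports Defs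
begin

text \<open>The proof compares two signals, the zero function and a bump \<open>f\<close> centred at \<open>x\<^sub>0\<close>. Let
\<open>b = (C / n) powr (\<beta> / (2 * \<beta> + 1))\<close>. A bump of height \<open>3 * b\<close> and width of order
\<open>n powr (- 1 / (2 * \<beta> + 1))\<close>, with the constant chosen suitably, lies in the Hoelder ball
(\<open>bump_in_holder_ball\<close>), while \<open>n\<close> times the square of its \<open>L\<^sup>2\<close> norm stays bounded. The latter means
that the laws of the data under the two signals cannot be told apart reliably. If the centres (means
or medians) of an estimator are within \<open>b\<close> of the true values at \<open>x\<^sub>0\<close>, then the centres for the two
signals are at least \<open>b\<close> apart. An estimator that concentrated around its centre under both
signals would therefore be a reliable test, which is impossible; so under one of the two signals it
deviates from its centre by a multiple of \<open>b\<close> on average (\<open>two_point_testing\<close>). Means and medians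
enter alike, through their distance to \<open>f x\<^sub>0\<close>, so both parts are instances of
\<open>deviation_lower_bound\<close>.

Indistinguishability is expressed by the inequality \<open>Q(A) \<le> 1/4 + K * P(A)\<close> for all events \<open>A\<close>, where
\<open>P\<close> and \<open>Q\<close> are the laws for the zero signal and for the bump and \<open>K\<close> is the exponential of
the bound on \<open>n\<close> times the energy. It is first proved for events that depend on the path at finitely
many times (\<open>cylinder_domination\<close>). There the data reduce to independent normal increments, and
the inequality follows from the second moment of the likelihood ratio (\<open>PiM_normal_shift_le\<close>), with a
constant that does not depend on the times. Since cylinders form an algebra that generates the
\<open>\<sigma>\<close>-algebra of the path space, every event is approximated by cylinders in \<open>P\<close> and \<open>Q\<close>
simultaneously, and the inequality carries over (\<open>affine_domination_extends\<close>).\<close>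

section \<open>Affine domination between product measures\<close>

lemma PiM_density:
  fixes P :: "'i \<Rightarrow> 'a measure" and L :: "'i \<Rightarrow> 'a \<Rightarrow> ennreal"
  assumes "finite I"
    and P: "\<And>i. prob_space (P i)"
    and L [measurable]: "\<And>i. L i \<in> borel_measurable (P i)"
    and Q: "\<And>i. prob_space (density (P i) (L i))"
  shows "PiM I (\<lambda>i. density (P i) (L i)) = density (PiM I P) (\<lambda>x. \<Prod>i\<in>I. L i (x i))"
proof -
  interpret P: product_sigma_finite P
    by (intro product_sigma_finite.intro prob_space_imp_sigma_finite P)
  interpret Q: product_sigma_finite "\<lambda>i. density (P i) (L i)"
    by (intro product_sigma_finite.intro prob_space_imp_sigma_finite Q)
  show ?thesis
  proof (rule Q.PiM_eqI[symmetric])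
    show "sets (density (PiM I P) (\<lambda>x. \<Prod>i\<in>I. L i (x i))) = sets (PiM I (\<lambda>i. density (P i) (L i)))"
      by (auto intro!: sets_PiM_cong)
    fix A assume A: "\<And>i. i \<in> I \<Longrightarrow> A i \<in> sets (density (P i) (L i))"
    then have A' [measurable]: "\<And>i. i \<in> I \<Longrightarrow> A i \<in> sets (P i)"
      by simp
    have box: "Pi\<^sub>E I A \<in> sets (PiM I P)"
      using assms(1) by (intro sets_PiM_I_finite) auto
    have "emeasure (density (PiM I P) (\<lambda>x. \<Prod>i\<in>I. L i (x i))) (Pi\<^sub>E I A)
        = (\<integral>\<^sup>+x. (\<Prod>i\<in>I. L i (x i)) * indicator (Pi\<^sub>E I A) x \<partial>PiM I P)"
      using assms(1) box by (intro emeasure_density) auto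
    also have "\<dots> = (\<integral>\<^sup>+x. (\<Prod>i\<in>I. L i (x i) * indicator (A i) (x i)) \<partial>PiM I P)"
    proof (intro nn_integral_cong)
      fix x assume "x \<in> space (PiM I P)"
      then have "x \<in> extensional I"
        by (auto simp: space_PiM PiE_def)
      then have "indicator (Pi\<^sub>E I A) x = (\<Prod>i\<in>I. indicator (A i) (x i) :: ennreal)"
        using assms(1) by (auto simp: indicator_def PiE_iff prod_zero_iff)
      then show "(\<Prod>i\<in>I. L i (x i)) * indicator (Pi\<^sub>E I A) x
          = (\<Prod>i\<in>I. L i (x i) * indicator (A i) (x i))"
        by (simp add: prod.distrib)
    qed
    also have "\<dots> = (\<Prod>i\<in>I. \<integral>\<^sup>+x. L i x * indicator (A i) x \<partial>P i)"
      using assms(1) by (intro P.product_nn_integral_prod) auto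
    also have "\<dots> = (\<Prod>i\<in>I. emeasure (density (P i) (L i)) (A i))"
      by (intro prod.cong refl emeasure_density[symmetric]) auto
    finally show "emeasure (density (PiM I P) (\<lambda>x. \<Prod>i\<in>I. L i (x i))) (Pi\<^sub>E I A)
        = (\<Prod>i\<in>I. emeasure (density (P i) (L i)) (A i))" .
  qed fact
qed

text \<open>The likelihood ratio \<open>\<Lambda> = (\<Prod>i\<in>I. L i (x i))\<close> satisfies \<open>\<Lambda> \<le> \<Lambda>\<^sup>2 / (4 * K) + K\<close> by the inequality of
arithmetic and geometric means. Multiplied by the indicator of \<open>B\<close> and integrated, this bounds the
second measure by the first, because independence turns the second moment of \<open>\<Lambda>\<close> into the product
of second moments, which is at most \<open>K\<close>. Compared with the Cauchy-Schwarz bound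
\<open>Q(B)\<^sup>2 \<le> K * P(B)\<close>, the affine form survives approximation of sets by mere linear arithmetic and is
just as good for testing.\<close>

lemma PiM_density_le:
  fixes P :: "'i \<Rightarrow> 'a measure" and L :: "'i \<Rightarrow> 'a \<Rightarrow> real"
  assumes "finite I"
    and P: "\<And>i. prob_space (P i)"
    and L [measurable]: "\<And>i. L i \<in> borel_measurable (P i)"
    and L_nonneg: "\<And>i x. 0 \<le> L i x"
    and Q: "\<And>i. prob_space (density (P i) (L i))"
    and K: "(\<Prod>i\<in>I. \<integral>\<^sup>+x. ennreal ((L i x)\<^sup>2) \<partial>P i) \<le> ennreal K" "K > 0"
    and B [measurable]: "B \<in> sets (PiM I P)"
  shows "measure (PiM I (\<lambda>i. density (P i) (L i))) B \<le> 1/4 + K * measure (PiM I P) B"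
proof -
  interpret P: product_sigma_finite P
    by (intro product_sigma_finite.intro prob_space_imp_sigma_finite P)
  interpret PP: prob_space "PiM I P"
    by (intro prob_space_PiM P)
  interpret QQ: prob_space "PiM I (\<lambda>i. density (P i) (L i))"
    by (intro prob_space_PiM Q)
  let ?L = "\<lambda>x. \<Prod>i\<in>I. L i (x i)"
  have "emeasure (PiM I (\<lambda>i. density (P i) (L i))) B
      = (\<integral>\<^sup>+x. ennreal (?L x) * indicator B x \<partial>PiM I P)"
    using assms(1) P Q
    by (subst PiM_density) (auto simp: emeasure_density prod_ennreal L_nonneg)
  also have "\<dots> \<le> (\<integral>\<^sup>+x. ennreal (1/(4*K)) * ennreal ((?L x)\<^sup>2) + ennreal K * indicator B x \<partial>PiM I P)"
  proof (intro nn_integral_mono)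
    fix x
    have "0 \<le> (?L x / (2*K) - 1)\<^sup>2 * K"
      using K by simp
    also have "\<dots> = (?L x)\<^sup>2 / (4*K) + K - ?L x"
      using K by (simp add: field_simps power2_eq_square)
    finally have "?L x \<le> 1/(4*K) * (?L x)\<^sup>2 + K"
      by simp
    then show "ennreal (?L x) * indicator B x
        \<le> ennreal (1/(4*K)) * ennreal ((?L x)\<^sup>2) + ennreal K * indicator B x"
      using K(2) by (auto simp: indicator_def ennreal_mult[symmetric] ennreal_plus[symmetric] simp del: ennreal_plus
        intro!: ennreal_leI)
  qed
  also have "\<dots> = ennreal (1/(4*K)) * (\<integral>\<^sup>+x. (\<Prod>i\<in>I. ennreal ((L i (x i))\<^sup>2)) \<partial>PiM I P) + ennreal K * emeasure (PiM I P) B"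
    by (subst nn_integral_add)
      (auto simp: nn_integral_cmult nn_integral_cmult_indicator prod_power_distrib prod_ennreal L_nonneg)
  also have "(\<integral>\<^sup>+x. (\<Prod>i\<in>I. ennreal ((L i (x i))\<^sup>2)) \<partial>PiM I P)
      = (\<Prod>i\<in>I. \<integral>\<^sup>+x. ennreal ((L i x)\<^sup>2) \<partial>P i)"
    using assms(1) by (intro P.product_nn_integral_prod) auto
  also have "ennreal (1/(4*K)) * (\<Prod>i\<in>I. \<integral>\<^sup>+x. ennreal ((L i x)\<^sup>2) \<partial>P i) \<le> ennreal (1/(4*K)) * ennreal K"
    by (intro mult_left_mono K) auto
  also have "ennreal (1/(4*K)) * ennreal K = ennreal (1/4)"
    using K(2) by (subst ennreal_mult[symmetric]) (auto simp: field_simps)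
  also have "ennreal (1/4) + ennreal K * emeasure (PiM I P) B = ennreal (1/4 + K * measure (PiM I P) B)"
    using K(2) by (simp add: PP.emeasure_eq_measure ennreal_mult)
  finally show ?thesis
    using K(2) by (simp add: QQ.emeasure_eq_measure ennreal_plus[symmetric] del: ennreal_plus)
qed

definition normal_measure :: "real \<Rightarrow> real \<Rightarrow> real measure" where
  "normal_measure m \<sigma> = density lborel (normal_density m \<sigma>)"

lemma prob_space_normal_measure: "\<sigma> > 0 \<Longrightarrow> prob_space (normal_measure m \<sigma>)"
  unfolding normal_measure_def by (rule prob_space_normal_density)

text \<open>The density is the finite-dimensional form of the Cameron-Martin formula.\<close>

lemma normal_measure_shift:
  assumes "\<sigma> > 0"
  shows "normal_measure d \<sigma> = density (normal_measure 0 \<sigma>) (\<lambda>x. exp ((2*d*x - d\<^sup>2) / (2*\<sigma>\<^sup>2)))"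
proof -
  have "normal_density d \<sigma> x = normal_density 0 \<sigma> x * exp ((2*d*x - d\<^sup>2) / (2*\<sigma>\<^sup>2))" for x
    using assms by (simp add: normal_density_def exp_add[symmetric] mult.assoc
      add_divide_distrib[symmetric] diff_divide_distrib[symmetric] power2_eq_square algebra_simps)
  then show ?thesis
    unfolding normal_measure_def
    by (subst density_density_eq) (auto simp: ennreal_mult[symmetric] )
qed

text \<open>Completing the square: multiplying the centred density by the squared likelihood ratio gives the
density shifted by \<open>2 * d\<close>, up to the factor \<open>exp (d\<^sup>2/\<sigma>\<^sup>2)\<close>.\<close>

lemma normal_shift_second_moment:
  assumes "\<sigma> > 0"
  shows "(\<integral>\<^sup>+x. ennreal ((exp ((2*d*x - d\<^sup>2) / (2*\<sigma>\<^sup>2)))\<^sup>2) \<partial>normal_measure 0 \<sigma>) = ennreal (exp (d\<^sup>2/\<sigma>\<^sup>2))"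
proof -
  have eq: "normal_density 0 \<sigma> x * (exp ((2*d*x - d\<^sup>2) / (2*\<sigma>\<^sup>2)))\<^sup>2 = exp (d\<^sup>2/\<sigma>\<^sup>2) * normal_density (2*d) \<sigma> x" for x
  proof -
    have "- (x\<^sup>2) / (2*\<sigma>\<^sup>2) + 2 * ((2*d*x - d\<^sup>2) / (2*\<sigma>\<^sup>2)) = d\<^sup>2/\<sigma>\<^sup>2 + - ((x - 2*d)\<^sup>2) / (2*\<sigma>\<^sup>2)"
      using assms by (simp add: field_simps power2_eq_square)
    then have "exp (- (x\<^sup>2) / (2*\<sigma>\<^sup>2)) * (exp ((2*d*x - d\<^sup>2) / (2*\<sigma>\<^sup>2)))\<^sup>2 = exp (d\<^sup>2/\<sigma>\<^sup>2) * exp (- ((x - 2*d)\<^sup>2) / (2*\<sigma>\<^sup>2))"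
      by (simp only: exp_add[symmetric] exp_double[symmetric])
    then show ?thesis
      by (simp add: normal_density_def)
  qed
  interpret prob_space "density lborel (normal_density (2*d) \<sigma>)"
    using assms by (rule prob_space_normal_density)
  have "(\<integral>\<^sup>+x. ennreal (normal_density (2*d) \<sigma> x) \<partial>lborel) = 1"
    using emeasure_space_1 by (simp add: emeasure_density)
  then show ?thesis
    unfolding normal_measure_def
    by (subst nn_integral_density)
      (auto simp: ennreal_mult[symmetric] eq, simp add: ennreal_mult nn_integral_cmult)
qed

lemma PiM_normal_shift_le:
  fixes d \<sigma> :: "'i \<Rightarrow> real"
  assumes "finite I" and \<sigma>: "\<And>i. \<sigma> i > 0" and E: "(\<Sum>i\<in>I. (d i)\<^sup>2 / (\<sigma> i)\<^sup>2) \<le> E"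
    and B: "B \<in> sets (PiM I (\<lambda>_. borel))"
  shows "measure (PiM I (\<lambda>i. normal_measure (d i) (\<sigma> i))) B
    \<le> 1/4 + exp E * measure (PiM I (\<lambda>i. normal_measure 0 (\<sigma> i))) B"
proof -
  let ?L = "\<lambda>i x. exp ((2*d i*x - (d i)\<^sup>2) / (2*(\<sigma> i)\<^sup>2))"
  have "measure (PiM I (\<lambda>i. density (normal_measure 0 (\<sigma> i)) (?L i))) B
    \<le> 1/4 + exp E * measure (PiM I (\<lambda>i. normal_measure 0 (\<sigma> i))) B"
  proof (rule PiM_density_le)
    have "(\<Prod>i\<in>I. \<integral>\<^sup>+x. ennreal ((?L i x)\<^sup>2) \<partial>normal_measure 0 (\<sigma> i)) = ennreal (exp (\<Sum>i\<in>I. (d i)\<^sup>2 / (\<sigma> i)\<^sup>2))"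
      using assms by (simp only: normal_shift_second_moment) (simp add: prod_ennreal exp_sum)
    also have "\<dots> \<le> ennreal (exp E)"
      using E by (intro ennreal_leI) simp
    finally show "(\<Prod>i\<in>I. \<integral>\<^sup>+x. ennreal ((?L i x)\<^sup>2) \<partial>normal_measure 0 (\<sigma> i)) \<le> ennreal (exp E)" .
    show "B \<in> sets (PiM I (\<lambda>i. normal_measure 0 (\<sigma> i)))"
      using B by (simp add: normal_measure_def cong: sets_PiM_cong)
  qed (auto simp: \<sigma> assms(1) prob_space_normal_measure normal_measure_shift[symmetric], simp_all add: normal_measure_def)
  then show ?thesis
    by (simp add: \<sigma> normal_measure_shift[symmetric])
qed

section \<open>From a generating algebra to the generated sigma-algebra\<close>

text \<open>The sets that the algebra approximates form a Dynkin system. Both measures have to be controlled by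
the same approximating set \<open>B\<close>; for a disjoint union this works because one finite number of pieces
exhausts the union up to \<open>e / 2\<close> in either measure.\<close>

lemma algebra_approximation:
  assumes P: "finite_measure P" and Q: "finite_measure Q"
    and sets_P: "sets P = sigma_sets \<Omega> \<A>" and sets_Q: "sets Q = sigma_sets \<Omega> \<A>"
    and alg: "algebra \<Omega> \<A>"
    and A: "A \<in> sigma_sets \<Omega> \<A>"
  shows "\<forall>e>0. \<exists>B\<in>\<A>. measure P (A - B \<union> (B - A)) < e \<and> measure Q (A - B \<union> (B - A)) < e"
proof -
  interpret algebra \<Omega> \<A> by fact
  interpret P: finite_measure P by fact
  interpret Q: finite_measure Q by fact
  have sub: "\<A> \<subseteq> sets P" "\<A> \<subseteq> sets Q"
    using sets_P sets_Q by auto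
  show ?thesis
    using Int_stable space_closed A
  proof (induction rule: sigma_sets_induct_disjoint)
    case (basic A)
    then show ?case by (auto intro!: bexI[of _ A])
  next
    case empty
    show ?case by (auto intro!: bexI[of _ "{}"])
  next
    case (compl A)
    have "\<Omega> - A - (\<Omega> - B) \<union> ((\<Omega> - B) - (\<Omega> - A)) = A - B \<union> (B - A)" if "B \<in> \<A>" for B
      using that sets_into_space[of B] sigma_sets_into_sp[OF space_closed compl.hyps] by auto
    with compl.IH show ?case
      by (metis compl_sets)
  next
    case (union F)
    show ?case
    proof (intro allI impI)
      fix e :: real assume e: "e > 0"
      let ?U = "\<lambda>m. \<Union>i<m. F i" and ?V = "\<Union>i. F i"
      have F: "\<And>i. F i \<in> sets P" "\<And>i. F i \<in> sets Q"
        using union.hyps sets_P sets_Q by auto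
      have U: "\<And>m. ?U m \<in> sets P" "\<And>m. ?U m \<in> sets Q"
        using F by auto
      have V: "?V \<in> sets P" "?V \<in> sets Q" using F by auto
      have UV: "(\<Union>m. ?U m) = ?V" by auto
      have inc: "incseq ?U" by (auto simp: incseq_def) (meson lessThan_iff order_less_le_trans)
      have "(\<lambda>m. measure P (?U m)) \<longlonglongrightarrow> measure P ?V" "(\<lambda>m. measure Q (?U m)) \<longlonglongrightarrow> measure Q ?V"
        using P.finite_Lim_measure_incseq[OF _ inc] Q.finite_Lim_measure_incseq[OF _ inc] U UV by auto
      then have "\<forall>\<^sub>F m in sequentially. measure P (?U m) > measure P ?V - e/2"
         "\<forall>\<^sub>F m in sequentially. measure Q (?U m) > measure Q ?V - e/2"
        using e by (auto intro!: order_tendstoD(1))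
      then obtain m where m: "measure P (?U m) > measure P ?V - e/2" "measure Q (?U m) > measure Q ?V - e/2"
        using eventually_happens[OF eventually_conj] by (metis (no_types, lifting) sequentially_bot)
      have tail: "measure P (?V - ?U m) < e/2" "measure Q (?V - ?U m) < e/2"
        using m U V by (subst P.finite_measure_Diff Q.finite_measure_Diff; force)+
      define e' where "e' = e / (2 * real (Suc m))"
      have e': "e' > 0" using e by (simp add: e'_def)
      have "\<forall>i. \<exists>B. B \<in> \<A> \<and> measure P (F i - B \<union> (B - F i)) < e' \<and> measure Q (F i - B \<union> (B - F i)) < e'"
        using union.IH e' by blast
      then obtain B where B: "\<And>i. B i \<in> \<A>" "\<And>i. measure P (F i - B i \<union> (B i - F i)) < e'"
          "\<And>i. measure Q (F i - B i \<union> (B i - F i)) < e'"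
        by metis
      let ?B = "\<Union>i<m. B i"
      have BA: "?B \<in> \<A>" using B by auto
      have Bs: "\<And>i. B i \<in> sets P" "\<And>i. B i \<in> sets Q" using B sub by auto
      have incl: "?V - ?B \<union> (?B - ?V) \<subseteq> (?V - ?U m) \<union> (\<Union>i<m. F i - B i \<union> (B i - F i))"
        by auto
      have small: "measure S (?V - ?B \<union> (?B - ?V)) < e"
        if "finite_measure S" "measure S (?V - ?U m) < e/2" "\<And>i. measure S (F i - B i \<union> (B i - F i)) < e'"
          "\<And>i. F i \<in> sets S" "\<And>i. B i \<in> sets S" for S
      proof -
        interpret S: finite_measure S by fact
        note [measurable] = that(4,5)
        have "measure S (?V - ?B \<union> (?B - ?V)) \<le> measure S ((?V - ?U m) \<union> (\<Union>i<m. F i - B i \<union> (B i - F i)))"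
          using incl by (intro S.finite_measure_mono) auto
        also have "\<dots> \<le> measure S (?V - ?U m) + measure S (\<Union>i<m. F i - B i \<union> (B i - F i))"
          by (intro measure_Un_le) auto
        also have "measure S (\<Union>i<m. F i - B i \<union> (B i - F i)) \<le> (\<Sum>i<m. measure S (F i - B i \<union> (B i - F i)))"
          by (intro S.finite_measure_subadditive_finite) auto
        also have "\<dots> \<le> (\<Sum>i<m. e')"
          using that(3) by (intro sum_mono) (simp add: less_imp_le)
        also have "\<dots> \<le> e/2"
          using e by (simp add: e'_def field_simps)
        finally show ?thesis using that(2) by simp
      qed
      show "\<exists>B\<in>\<A>. measure P (?V - B \<union> (B - ?V)) < e \<and> measure Q (?V - B \<union> (B - ?V)) < e"
        using BA small[OF P tail(1) B(2) F(1) Bs(1)] small[OF Q tail(2) B(3) F(2) Bs(2)] by blast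
    qed
  qed
qed

lemma affine_domination_extends:
  assumes P: "finite_measure P" and Q: "finite_measure Q"
    and sets_P: "sets P = sigma_sets \<Omega> \<A>" and sets_Q: "sets Q = sigma_sets \<Omega> \<A>"
    and alg: "algebra \<Omega> \<A>"
    and le: "\<And>B. B \<in> \<A> \<Longrightarrow> measure Q B \<le> c + K * measure P B" and "K \<ge> 0"
    and A: "A \<in> sets P"
  shows "measure Q A \<le> c + K * measure P A"
proof (rule field_le_epsilon)
  interpret P: finite_measure P by fact
  interpret Q: finite_measure Q by fact
  fix e :: real assume e: "e > 0"
  define e' where "e' = e / (1 + K)"
  have "1 + K > 0"
    using \<open>K \<ge> 0\<close> by simp
  then have e': "e' > 0" "e' * (1 + K) = e"
    using e by (simp_all add: e'_def)
  obtain B where B: "B \<in> \<A>" "measure P (A - B \<union> (B - A)) < e'" "measure Q (A - B \<union> (B - A)) < e'"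
    using algebra_approximation[OF P Q sets_P sets_Q alg] A e' sets_P by metis
  have [measurable]: "B \<in> sets P" "B \<in> sets Q" "A \<in> sets P" "A \<in> sets Q"
    using B A sets_P sets_Q by auto
  have "measure Q A \<le> measure Q (B \<union> (A - B \<union> (B - A)))"
    by (intro Q.finite_measure_mono) auto
  also have "\<dots> \<le> measure Q B + measure Q (A - B \<union> (B - A))"
    by (intro measure_Un_le) auto
  finally have 1: "measure Q A \<le> measure Q B + e'"
    using B by simp
  have "measure P B \<le> measure P (A \<union> (A - B \<union> (B - A)))"
    by (intro P.finite_measure_mono) auto
  also have "\<dots> \<le> measure P A + measure P (A - B \<union> (B - A))"
    by (intro measure_Un_le) auto
  finally have 2: "K * measure P B \<le> K * (measure P A + e')"
    using B \<open>K \<ge> 0\<close> by (intro mult_left_mono) auto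
  show "measure Q A \<le> c + K * measure P A + e"
    using 1 2 le[OF B(1)] e'(2)[symmetric] by (simp add: algebra_simps)
qed

section \<open>Path space and its cylinder sets\<close>

definition cylinder_sets :: "(real \<Rightarrow> real) set set" where
  "cylinder_sets = (\<Union>J\<in>{J. finite J \<and> J \<subseteq> {0..1}}.
     {(\<lambda>y. restrict y J) -` B \<inter> space path_space |B. B \<in> sets (\<Pi>\<^sub>M x\<in>J. borel)})"

lemma space_path_space: "space path_space = extensional {0..1} \<inter> {y. continuous_on {0..1} y}"
  by (auto simp: path_space_def space_restrict_space space_PiM PiE_def)

lemma measurable_path_eval: "x \<in> {0..1} \<Longrightarrow> (\<lambda>y. y x) \<in> borel_measurable path_space"
  unfolding path_space_def by (intro measurable_restrict_space1 measurable_component_singleton)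

lemma measurable_path_restrict:
  assumes "J \<subseteq> {0..1}"
  shows "(\<lambda>y. restrict y J) \<in> path_space \<rightarrow>\<^sub>M (\<Pi>\<^sub>M x\<in>J. borel)"
  using assms by (intro measurable_restrict measurable_path_eval) auto

text \<open>The \<open>\<sigma>\<close>-algebra of the path space is the trace of a product \<open>\<sigma>\<close>-algebra, so evaluations at points suffice.\<close>

lemma measurable_into_path_space:
  assumes "\<And>\<omega>. \<omega> \<in> space M \<Longrightarrow> X \<omega> \<in> space path_space"
    and "\<And>x. x \<in> {0..1} \<Longrightarrow> (\<lambda>\<omega>. X \<omega> x) \<in> borel_measurable M"
  shows "X \<in> M \<rightarrow>\<^sub>M path_space"
proof -
  have "X \<in> M \<rightarrow>\<^sub>M (\<Pi>\<^sub>M x\<in>{0..1}. borel)"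
    using assms by (intro measurable_PiM_single') (auto simp: space_path_space extensional_def)
  then show ?thesis
    unfolding path_space_def using assms(1)
    by (intro measurable_restrict_space2) (auto simp: space_path_space)
qed

text \<open>Any two cylinders can be described by the same finite set of times; this is what makes the cylinders
closed under unions.\<close>

lemma cylinder_enlarge:
  assumes "B \<in> sets (\<Pi>\<^sub>M x\<in>J. borel)" "J \<subseteq> J'"
  obtains B' where "B' \<in> sets (\<Pi>\<^sub>M x\<in>J'. borel)"
    "(\<lambda>y. restrict y J) -` B \<inter> S = (\<lambda>y. restrict y J') -` B' \<inter> (S :: (real \<Rightarrow> real) set)"
proof
  show "(\<lambda>y. restrict y J) -` B \<inter> space (\<Pi>\<^sub>M x\<in>J'. borel) \<in> sets (\<Pi>\<^sub>M x\<in>J'. borel)"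
    using assms by (intro measurable_sets[OF measurable_restrict_subset]) auto
  have "restrict (restrict y J') J = restrict y J" for y :: "real \<Rightarrow> real"
    using assms(2) by (auto simp: restrict_def fun_eq_iff)
  then show "(\<lambda>y. restrict y J) -` B \<inter> S
      = (\<lambda>y. restrict y J') -` ((\<lambda>y. restrict y J) -` B \<inter> space (\<Pi>\<^sub>M x\<in>J'. borel)) \<inter> S"
    by (auto simp: space_PiM)
qed

lemma algebra_cylinder_sets: "algebra (space path_space) cylinder_sets"
proof (subst algebra_iff_Un, intro conjI ballI)
  show "cylinder_sets \<subseteq> Pow (space path_space)"
    by (auto simp: cylinder_sets_def)
  show "{} \<in> cylinder_sets"
    unfolding cylinder_sets_def by (auto intro!: exI[of _ "{}"])
next
  fix A assume "A \<in> cylinder_sets"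
  then obtain J B where J: "finite J" "J \<subseteq> {0..1}" "B \<in> sets (\<Pi>\<^sub>M x\<in>J. borel)"
    and A: "A = (\<lambda>y. restrict y J) -` B \<inter> space path_space"
    unfolding cylinder_sets_def by blast
  have "space path_space - A = (\<lambda>y. restrict y J) -` (space (\<Pi>\<^sub>M x\<in>J. borel) - B) \<inter> space path_space"
    by (auto simp: A space_PiM)
  then show "space path_space - A \<in> cylinder_sets"
    unfolding cylinder_sets_def using J by blast
next
  fix A1 A2 assume "A1 \<in> cylinder_sets" "A2 \<in> cylinder_sets"
  then obtain J1 B1 J2 B2 where J: "finite J1" "J1 \<subseteq> {0..1}" "B1 \<in> sets (\<Pi>\<^sub>M x\<in>J1. borel)"
      "finite J2" "J2 \<subseteq> {0..1}" "B2 \<in> sets (\<Pi>\<^sub>M x\<in>J2. borel)"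
    and A: "A1 = (\<lambda>y. restrict y J1) -` B1 \<inter> space path_space"
      "A2 = (\<lambda>y. restrict y J2) -` B2 \<inter> space path_space"
    unfolding cylinder_sets_def by blast
  obtain B1' where B1': "B1' \<in> sets (\<Pi>\<^sub>M x\<in>J1 \<union> J2. borel)"
    "A1 = (\<lambda>y. restrict y (J1 \<union> J2)) -` B1' \<inter> space path_space"
    using cylinder_enlarge[OF J(3), of "J1 \<union> J2"] A by blast
  obtain B2' where B2': "B2' \<in> sets (\<Pi>\<^sub>M x\<in>J1 \<union> J2. borel)"
    "A2 = (\<lambda>y. restrict y (J1 \<union> J2)) -` B2' \<inter> space path_space"
    using cylinder_enlarge[OF J(6), of "J1 \<union> J2"] A by blast
  have "A1 \<union> A2 = (\<lambda>y. restrict y (J1 \<union> J2)) -` (B1' \<union> B2') \<inter> space path_space"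
    using B1' B2' by auto
  moreover have "B1' \<union> B2' \<in> sets (\<Pi>\<^sub>M x\<in>J1 \<union> J2. borel)"
    using B1' B2' by auto
  moreover have "finite (J1 \<union> J2)" "J1 \<union> J2 \<subseteq> {0..1}"
    using J by auto
  ultimately show "A1 \<union> A2 \<in> cylinder_sets"
    unfolding cylinder_sets_def by blast
qed

lemma sets_path_space: "sets path_space = sigma_sets (space path_space) cylinder_sets"
proof
  let ?S = "sigma (space path_space) cylinder_sets"
  have sub: "cylinder_sets \<subseteq> Pow (space path_space)"
    by (auto simp: cylinder_sets_def)
  have cyl: "cylinder_sets \<subseteq> sets path_space"
    unfolding cylinder_sets_def using measurable_sets[OF measurable_path_restrict] by blast
  then show "sigma_sets (space path_space) cylinder_sets \<subseteq> sets path_space"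
    by (rule sets.sigma_sets_subset)
  have "(\<lambda>y. y) \<in> ?S \<rightarrow>\<^sub>M path_space"
  proof (rule measurable_into_path_space)
    fix x :: real assume x: "x \<in> {0..1}"
    show "(\<lambda>y. y x) \<in> borel_measurable ?S"
    proof (rule measurableI)
      fix A :: "real set" assume A: "A \<in> sets borel"
      then have "(\<lambda>z. z x) -` A \<inter> space (\<Pi>\<^sub>M x\<in>{x}. borel) \<in> sets (\<Pi>\<^sub>M x\<in>{x}. borel)"
        by (intro measurable_sets[OF measurable_component_singleton]) auto
      moreover have "(\<lambda>y. y x) -` A \<inter> space ?S
        = (\<lambda>y. restrict y {x}) -` ((\<lambda>z. z x) -` A \<inter> space (\<Pi>\<^sub>M x\<in>{x}. borel)) \<inter> space path_space"
        using sub by (auto simp: space_PiM space_measure_of)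
      ultimately have "(\<lambda>y. y x) -` A \<inter> space ?S \<in> cylinder_sets"
        unfolding cylinder_sets_def using x by blast
      then show "(\<lambda>y. y x) -` A \<inter> space ?S \<in> sets ?S"
        using sub by (auto simp: sets_measure_of)
    qed auto
  qed (use sub in \<open>auto simp: space_measure_of\<close>)
  from measurable_sets[OF this] show "sets path_space \<subseteq> sigma_sets (space path_space) cylinder_sets"
    using sub sets.sets_into_space[of _ path_space] by (fastforce simp: Int_absorb2)
qed

section \<open>The law of the observation\<close>

abbreviation signal_integral :: "(real \<Rightarrow> real) \<Rightarrow> real \<Rightarrow> real" where
  "signal_integral f x \<equiv> (LBINT t:{0..x}. f t)"

lemma signal_integral_eq:
  assumes "continuous_on {0..1} f" "x \<in> {0..1}"
  shows "signal_integral f x = integral {0..x} f"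
proof (intro set_borel_integral_eq_integral)
  show "set_integrable lborel {0..x} f"
    using assms by (intro borel_integrable_atLeastAtMost' continuous_on_subset[OF assms(1)]) auto
qed

lemma continuous_on_signal_integral:
  assumes "continuous_on {0..1} f"
  shows "continuous_on {0..1} (signal_integral f)"
  using indefinite_integral_continuous_1[OF integrable_continuous_interval[OF assms]]
  by (rule continuous_on_eq) (simp add: signal_integral_eq[OF assms])

lemma brownian_motion_props:
  assumes "standard_brownian_motion M W"
  shows "prob_space M" "t \<in> {0..1} \<Longrightarrow> W t \<in> borel_measurable M"
    "\<omega> \<in> space M \<Longrightarrow> W 0 \<omega> = 0" "\<omega> \<in> space M \<Longrightarrow> continuous_on {0..1} (\<lambda>t. W t \<omega>)"
    "0 \<le> s \<Longrightarrow> s < t \<Longrightarrow> t \<le> 1 \<Longrightarrow>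
       distributed M lborel (\<lambda>\<omega>. W t \<omega> - W s \<omega>) (normal_density 0 (sqrt (t - s)))"
    "0 \<le> u 0 \<Longrightarrow> (\<And>i. i < k \<Longrightarrow> u i \<le> u (Suc i)) \<Longrightarrow> u k \<le> 1 \<Longrightarrow>
       prob_space.indep_vars M (\<lambda>_. borel) (\<lambda>i \<omega>. W (u (Suc i)) \<omega> - W (u i) \<omega>) {..<k::nat}"
  using assms unfolding standard_brownian_motion_def by blast+

lemma measurable_observation:
  assumes W: "standard_brownian_motion M W" and f: "continuous_on {0..1} f"
  shows "observation W n f \<in> M \<rightarrow>\<^sub>M path_space"
proof (rule measurable_into_path_space)
  fix \<omega> assume "\<omega> \<in> space M"
  then have "continuous_on {0..1} (\<lambda>x. signal_integral f x + W x \<omega> / sqrt (real n))"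
    using f by (auto intro!: continuous_intros continuous_on_signal_integral simp: divide_inverse brownian_motion_props[OF W])
  then show "observation W n f \<omega> \<in> space path_space"
    by (auto simp: space_path_space observation_def elim!: continuous_on_eq)
next
  fix x :: real assume "x \<in> {0..1}"
  then show "(\<lambda>\<omega>. observation W n f \<omega> x) \<in> borel_measurable M"
    using brownian_motion_props(2)[OF W, of x] by (simp add: observation_def)
qed

text \<open>Only the means depend on the signal, so the likelihood ratio of two signals on a grid is a product
of ratios of normal densities with equal variances.\<close>

lemma increments_law:
  assumes W: "standard_brownian_motion M W" and "n > 0"
    and t: "t 0 \<ge> 0" "\<And>i. i < k \<Longrightarrow> t i < t (Suc i)" "t k \<le> 1" and "k > 0"
  shows "distr M (\<Pi>\<^sub>M i\<in>{..<k}. borel)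
      (\<lambda>\<omega>. \<lambda>i\<in>{..<k}. observation W n f \<omega> (t (Suc i)) - observation W n f \<omega> (t i))
    = (\<Pi>\<^sub>M i\<in>{..<k}. normal_measure (signal_integral f (t (Suc i)) - signal_integral f (t i))
         (sqrt ((t (Suc i) - t i) / real n)))"
proof -
  interpret prob_space M by (rule brownian_motion_props(1)[OF W])
  define d where "d = (\<lambda>i. signal_integral f (t (Suc i)) - signal_integral f (t i))"
  define D where "D = (\<lambda>i \<omega>. d i + 1 / sqrt (real n) * (W (t (Suc i)) \<omega> - W (t i) \<omega>))"
  have mono: "i \<le> j \<Longrightarrow> j \<le> k \<Longrightarrow> t i \<le> t j" for i j
  proof (induction j rule: dec_induct)
    case (step j)
    then show ?case using t(2)[of j] by simp
  qed simp
  have range: "i \<le> k \<Longrightarrow> t i \<in> {0..1}" for i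
    using mono[of 0 i] mono[of i k] t by auto
  have incr: "observation W n f \<omega> (t (Suc i)) - observation W n f \<omega> (t i) = D i \<omega>" if "i < k" for i \<omega>
    using range[of i] range[of "Suc i"] that
    by (simp add: observation_def D_def d_def diff_divide_distrib)
  have rv: "i < k \<Longrightarrow> D i \<in> borel_measurable M" for i
    unfolding D_def using range[of i] range[of "Suc i"]
    by (intro borel_measurable_add borel_measurable_times borel_measurable_diff brownian_motion_props(2)[OF W]) auto
  have "indep_vars (\<lambda>_. borel) (\<lambda>i \<omega>. W (t (Suc i)) \<omega> - W (t i) \<omega>) {..<k}"
    using t by (intro brownian_motion_props(6)[OF W]) (auto intro: less_imp_le)
  then have indep: "indep_vars (\<lambda>_. borel) D {..<k}"
    unfolding D_def by (rule indep_vars_compose2) auto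
  have law: "distr M borel (D i) = normal_measure (d i) (sqrt ((t (Suc i) - t i) / real n))" if "i < k" for i
  proof -
    have "distributed M lborel (\<lambda>\<omega>. W (t (Suc i)) \<omega> - W (t i) \<omega>) (normal_density 0 (sqrt (t (Suc i) - t i)))"
      using t(2) range[of i] range[of "Suc i"] that by (intro brownian_motion_props(5)[OF W]) auto
    then have "distributed M lborel (D i)
        (normal_density (d i + 1 / sqrt (real n) * 0) (\<bar>1 / sqrt (real n)\<bar> * sqrt (t (Suc i) - t i)))"
      unfolding D_def using t that \<open>n > 0\<close> by (intro normal_density_affine) auto
    moreover have "\<bar>1 / sqrt (real n)\<bar> * sqrt (t (Suc i) - t i) = sqrt ((t (Suc i) - t i) / real n)"
      by (simp add: real_sqrt_divide)
    ultimately have "distr M lborel (D i) = normal_measure (d i) (sqrt ((t (Suc i) - t i) / real n))"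
      unfolding normal_measure_def by (simp add: distributed_distr_eq_density)
    moreover have "distr M lborel (D i) = distr M borel (D i)"
      by (rule distr_cong) auto
    ultimately show ?thesis by simp
  qed
  have "distr M (\<Pi>\<^sub>M i\<in>{..<k}. borel)
      (\<lambda>\<omega>. \<lambda>i\<in>{..<k}. observation W n f \<omega> (t (Suc i)) - observation W n f \<omega> (t i))
    = distr M (\<Pi>\<^sub>M i\<in>{..<k}. borel) (\<lambda>\<omega>. \<lambda>i\<in>{..<k}. D i \<omega>)"
    by (intro distr_cong refl) (auto simp: incr restrict_def)
  also have "\<dots> = (\<Pi>\<^sub>M i\<in>{..<k}. distr M borel (D i))"
    using indep_vars_iff_distr_eq_PiM'[where I = "{..<k}" and X = D and M' = "\<lambda>_. borel"] indep rv \<open>k > 0\<close> by auto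
  also have "\<dots> = (\<Pi>\<^sub>M i\<in>{..<k}. normal_measure (d i) (sqrt ((t (Suc i) - t i) / real n)))"
    by (intro PiM_cong refl) (auto simp: law)
  finally show ?thesis
    by (simp add: d_def)
qed

lemma finite_set_enumerate:
  fixes J :: "real set"
  assumes "finite J" "J \<subseteq> {0..1}" "0 \<in> J" "1 \<in> J"
  shows "\<exists>t k. k > 0 \<and> t 0 = 0 \<and> t k = 1 \<and> (\<forall>i<k. t i < t (Suc i)) \<and> J = t ` {..k::nat}"
proof (intro exI conjI allI impI)
  define xs where "xs = sorted_list_of_set J"
  define k where "k = length xs - 1"
  have set_xs: "set xs = J" and sorted: "sorted_wrt (<) xs"
    using assms(1) by (auto simp: xs_def)
  have "card J \<ge> card {0::real, 1}"
    using assms by (intro card_mono) auto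
  then have len: "length xs = Suc k" "k > 0"
    using assms(1) by (auto simp: k_def xs_def)
  show "k > 0" by fact
  show J: "J = (\<lambda>i. xs ! i) ` {..k}"
    using set_xs len by (auto simp: set_conv_nth image_iff less_Suc_eq_le)
  have less: "i < j \<Longrightarrow> j \<le> k \<Longrightarrow> xs ! i < xs ! j" for i j
    using sorted len by (simp add: sorted_wrt_iff_nth_less)
  show "i < k \<Longrightarrow> xs ! i < xs ! Suc i" for i
    using less by simp
  have bounds: "i \<le> k \<Longrightarrow> 0 \<le> xs ! i \<and> xs ! i \<le> 1" for i
    using assms(2) J by auto
  obtain a b where ab: "a \<le> k" "xs ! a = 0" "b \<le> k" "xs ! b = 1"
    using assms(3,4) J by (metis atMost_iff imageE)
  show "xs ! 0 = 0"
    using less[of 0 a] ab bounds[of 0] by (cases "a = 0") auto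
  show "xs ! k = 1"
    using less[of b k] ab bounds[of k] by (cases "b = k") auto
qed


text \<open>A cylinder over the grid points \<open>0 = t 0 < \<dots> < t k = 1\<close> is an event about the \<open>k\<close> increments of the
path. These are independent normal variables with standard deviations \<open>\<sigma> i\<close>, and the signal shifts
their means by \<open>d i\<close>. The increments of \<open>G\<close> bound the energy of the signal: each shift satisfies
\<open>(d i)\<^sup>2 / (\<sigma> i)\<^sup>2 \<le> n * (G (t (Suc i)) - G (t i))\<close>, and these bounds telescope to one that does not
depend on the grid. So the same constant serves all cylinders.\<close>

lemma cylinder_domination:
  assumes W: "standard_brownian_motion M W" and "n > 0" and f: "continuous_on {0..1} f"
    and energy: "\<And>s t. 0 \<le> s \<Longrightarrow> s < t \<Longrightarrow> t \<le> 1 \<Longrightarrow>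
        (signal_integral f t - signal_integral f s)\<^sup>2 \<le> (t - s) * (G t - G s)"
    and E: "real n * (G 1 - G 0) \<le> E"
    and A: "A \<in> cylinder_sets"
  shows "measure (data_law M W n f) A \<le> 1/4 + exp E * measure (data_law M W n (\<lambda>_. 0)) A"
proof -
  interpret prob_space M by (rule brownian_motion_props(1)[OF W])
  obtain J0 B0 where J0: "finite J0" "J0 \<subseteq> {0..1}" "B0 \<in> sets (\<Pi>\<^sub>M x\<in>J0. borel)"
    and A0: "A = (\<lambda>y. restrict y J0) -` B0 \<inter> space path_space"
    using A unfolding cylinder_sets_def by blast
  \<comment> \<open>Adding the end points lets the increments determine the path on the grid and the energies add up over \<open>[0,1]\<close>.\<close>
  define J where "J = J0 \<union> {0, 1}"
  have J: "finite J" "J \<subseteq> {0..1}" "0 \<in> J" "1 \<in> J"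
    using J0 by (auto simp: J_def)
  have "J0 \<subseteq> J"
    by (auto simp: J_def)
  then obtain B where B: "B \<in> sets (\<Pi>\<^sub>M x\<in>J. borel)" and A: "A = (\<lambda>y. restrict y J) -` B \<inter> space path_space"
    using cylinder_enlarge[OF J0(3), of J "space path_space"] unfolding A0 by metis
  obtain t k where t0: "k > 0" "t 0 = 0" "t k = 1" "\<forall>i<k. t i < t (Suc i)" and Jt: "J = t ` {..k::nat}"
    using finite_set_enumerate[OF J] by (elim exE conjE) (rule that)
  have t: "k > 0" "t 0 = 0" "t k = 1" "i < k \<Longrightarrow> t i < t (Suc i)" for i
    using t0 by auto
  \<comment> \<open>The path starts at 0, so its value at a grid point is the sum of the earlier increments.\<close>
  define h where "h = (\<lambda>z::nat \<Rightarrow> real. \<lambda>j\<in>J. \<Sum>i<k. if t (Suc i) \<le> j then z i else 0)"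
  have "h \<in> (\<Pi>\<^sub>M i\<in>{..<k}. borel) \<rightarrow>\<^sub>M (\<Pi>\<^sub>M j\<in>J. borel)"
    unfolding h_def
  proof (intro measurable_restrict borel_measurable_sum)
    fix j i assume "i \<in> {..<k}"
    then show "(\<lambda>z. if t (Suc i) \<le> j then z i else 0) \<in> borel_measurable (\<Pi>\<^sub>M i\<in>{..<k}. borel)"
      by (cases "t (Suc i) \<le> j") (auto intro: measurable_component_singleton)
  qed
  then have B': "h -` B \<inter> space (\<Pi>\<^sub>M i\<in>{..<k}. borel) \<in> sets (\<Pi>\<^sub>M i\<in>{..<k}. borel)" (is "?B' \<in> _")
    using B by (rule measurable_sets)
  have range: "i \<le> k \<Longrightarrow> t i \<in> {0..1}" for i
    using J(2) Jt by auto
  have mono: "t i < t j" if "i < j" "j \<le> k" for i j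
    using that
  proof (induction j)
    case (Suc j)
    then show ?case using t(4)[of j] by (cases "i = j") auto
  qed simp
  have law: "measure (data_law M W n g) A
      = measure (\<Pi>\<^sub>M i\<in>{..<k}. normal_measure (signal_integral g (t (Suc i)) - signal_integral g (t i))
         (sqrt ((t (Suc i) - t i) / real n))) ?B'" if g: "continuous_on {0..1} g" for g
  proof -
    let ?Y = "observation W n g"
    let ?D = "\<lambda>\<omega>. \<lambda>i\<in>{..<k}. ?Y \<omega> (t (Suc i)) - ?Y \<omega> (t i)"
    have D: "?D \<in> M \<rightarrow>\<^sub>M (\<Pi>\<^sub>M i\<in>{..<k}. borel)"
      by (intro measurable_restrict borel_measurable_diff
          measurable_compose[OF measurable_observation[OF W g] measurable_path_eval]) (rule range, simp)+
    have "restrict (?Y \<omega>) J = h (?D \<omega>)" if "\<omega> \<in> space M" for \<omega>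
    proof -
      have "?Y \<omega> (t m) = (\<Sum>i<k. if t (Suc i) \<le> t m then ?D \<omega> i else 0)" if "m \<le> k" for m
      proof -
        have "?Y \<omega> 0 = 0"
          using brownian_motion_props(3)[OF W \<open>\<omega> \<in> space M\<close>]
          using signal_integral_eq[OF g, of 0] by (simp add: observation_def)
        then have "?Y \<omega> (t m) = (\<Sum>i<m. ?Y \<omega> (t (Suc i)) - ?Y \<omega> (t i))"
          by (simp add: sum_lessThan_telescope[of "\<lambda>i. ?Y \<omega> (t i)"] t)
        also have "\<dots> = (\<Sum>i\<in>{i\<in>{..<k}. t (Suc i) \<le> t m}. ?D \<omega> i)"
        proof (rule sum.cong)
          have "t (Suc i) \<le> t m \<longleftrightarrow> i < m" if "i < k" for i
            using mono[of "Suc i" m] mono[of m "Suc i"] that \<open>m \<le> k\<close> 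
            by (cases "Suc i" m rule: linorder_cases) auto
          then show "{..<m} = {i\<in>{..<k}. t (Suc i) \<le> t m}"
            using \<open>m \<le> k\<close> by auto
        qed auto
        finally show ?thesis
          by (simp only: sum.inter_filter[OF finite_lessThan])
      qed
      then have eq: "?Y \<omega> j = (\<Sum>i<k. if t (Suc i) \<le> j then ?D \<omega> i else 0)" if "j \<in> J" for j
        using that unfolding Jt by blast
      show ?thesis
        unfolding h_def by (rule restrict_ext) (rule eq)
    qed
    then have "\<omega> \<in> space M \<Longrightarrow> ?Y \<omega> \<in> A \<longleftrightarrow> ?D \<omega> \<in> ?B'" for \<omega>
      using measurable_space[OF measurable_observation[OF W g], of \<omega>] measurable_space[OF D, of \<omega>]
      unfolding A Int_iff vimage_eq by presburger
    then have "?Y -` A \<inter> space M = ?D -` ?B' \<inter> space M"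
      by blast
    moreover have "A \<in> sets path_space"
      unfolding A by (rule measurable_sets[OF measurable_path_restrict[OF J(2)] B])
    ultimately have "measure (data_law M W n g) A = measure (distr M (\<Pi>\<^sub>M i\<in>{..<k}. borel) ?D) ?B'"
      unfolding data_law_def
      by (simp only: measure_distr[OF measurable_observation[OF W g]] measure_distr[OF D B'])
    also have "distr M (\<Pi>\<^sub>M i\<in>{..<k}. borel) ?D =
        (\<Pi>\<^sub>M i\<in>{..<k}. normal_measure (signal_integral g (t (Suc i)) - signal_integral g (t i))
         (sqrt ((t (Suc i) - t i) / real n)))"
      using t by (intro increments_law[OF W \<open>n > 0\<close>]) auto
    finally show ?thesis .
  qed
  define d where "d = (\<lambda>i. signal_integral f (t (Suc i)) - signal_integral f (t i))"
  \<comment> \<open>The value 1 beyond the grid makes every factor a probability measure.\<close>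
  define \<sigma> where "\<sigma> = (\<lambda>i. if i < k then sqrt ((t (Suc i) - t i) / real n) else 1)"
  have "(\<Sum>i<k. (d i)\<^sup>2 / (\<sigma> i)\<^sup>2) \<le> (\<Sum>i<k. real n * (G (t (Suc i)) - G (t i)))"
  proof (rule sum_mono)
    fix i assume "i \<in> {..<k}"
    then have i: "t i < t (Suc i)" "0 \<le> t i" "t (Suc i) \<le> 1" "i < k"
      using t(4) range[of i] range[of "Suc i"] by auto
    have "(d i)\<^sup>2 / (\<sigma> i)\<^sup>2 = real n * ((d i)\<^sup>2 / (t (Suc i) - t i))"
      using i \<open>n > 0\<close> by (simp add: \<sigma>_def field_simps)
    also have "\<dots> \<le> real n * (G (t (Suc i)) - G (t i))"
      using energy[of "t i" "t (Suc i)"] i by (intro mult_left_mono) (auto simp: d_def divide_le_eq mult.commute)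
    finally show "(d i)\<^sup>2 / (\<sigma> i)\<^sup>2 \<le> real n * (G (t (Suc i)) - G (t i))" .
  qed
  also have "\<dots> = real n * (G 1 - G 0)"
    by (simp add: sum_distrib_left[symmetric] sum_lessThan_telescope[of "\<lambda>i. G (t i)"] t)
  finally have "(\<Sum>i<k. (d i)\<^sup>2 / (\<sigma> i)\<^sup>2) \<le> E"
    using E by simp
  moreover have "\<sigma> i > 0" for i
    using t(4) \<open>n > 0\<close> by (simp add: \<sigma>_def)
  ultimately have "measure (\<Pi>\<^sub>M i\<in>{..<k}. normal_measure (d i) (\<sigma> i)) ?B'
      \<le> 1/4 + exp E * measure (\<Pi>\<^sub>M i\<in>{..<k}. normal_measure 0 (\<sigma> i)) ?B'"
    using B' by (intro PiM_normal_shift_le) auto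
  moreover have "signal_integral (\<lambda>_. 0) x = 0" for x
    by (simp add: set_lebesgue_integral_def)
  moreover have "(\<Pi>\<^sub>M i\<in>{..<k}. normal_measure (e i) (\<sigma> i))
      = (\<Pi>\<^sub>M i\<in>{..<k}. normal_measure (e i) (sqrt ((t (Suc i) - t i) / real n)))" for e
    by (intro PiM_cong) (auto simp: \<sigma>_def)
  ultimately show ?thesis
    unfolding law[OF f] law[OF continuous_on_const] by (simp add: d_def)
qed

text \<open>The Cameron-Martin density of the two laws would give the same conclusion. Here a bound that is
uniform over the cylinders passes to all measurable events by approximation.\<close>

lemma data_law_domination:
  assumes W: "standard_brownian_motion M W" and "n > 0" and f: "continuous_on {0..1} f"
    and energy: "\<And>s t. 0 \<le> s \<Longrightarrow> s < t \<Longrightarrow> t \<le> 1 \<Longrightarrow>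
        (signal_integral f t - signal_integral f s)\<^sup>2 \<le> (t - s) * (G t - G s)"
    and E: "real n * (G 1 - G 0) \<le> E"
    and A: "A \<in> sets path_space"
  shows "measure (data_law M W n f) A \<le> 1/4 + exp E * measure (data_law M W n (\<lambda>_. 0)) A"
proof -
  interpret prob_space M by (rule brownian_motion_props(1)[OF W])
  have fin: "finite_measure (data_law M W n g)" if "continuous_on {0..1} g" for g
    unfolding data_law_def by (intro finite_measure_distr measurable_observation[OF W that])
  have sets_law: "sets (data_law M W n g) = sigma_sets (space path_space) cylinder_sets" for g
    by (simp add: data_law_def sets_path_space)
  have zero: "continuous_on {0..1} (\<lambda>_. 0 :: real)"
    by simp
  have "A \<in> sets (data_law M W n (\<lambda>_. 0))"
    using A by (simp add: data_law_def)
  then show ?thesis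
    by (rule affine_domination_extends[OF fin[OF zero] fin[OF f] sets_law sets_law algebra_cylinder_sets, rotated 2])
      (rule cylinder_domination[OF W \<open>n > 0\<close> f _ E], rule energy, simp_all)
qed

section \<open>A Gaussian bump in the Hoelder ball\<close>

text \<open>Up to sign these are the Hermite polynomials, which makes \<open>gauss_deriv l\<close> below the \<open>l\<close>-th derivative
of \<open>exp (- (x\<^sup>2))\<close>.\<close>

fun gauss_poly :: "nat \<Rightarrow> real poly" where
  "gauss_poly 0 = 1"
| "gauss_poly (Suc l) = pderiv (gauss_poly l) - [:0, 2:] * gauss_poly l"

definition gauss_deriv :: "nat \<Rightarrow> real \<Rightarrow> real" where
  "gauss_deriv l x = poly (gauss_poly l) x * exp (- (x\<^sup>2))"

lemma gauss_deriv_0: "gauss_deriv 0 x = exp (- (x\<^sup>2))"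
  by (simp add: gauss_deriv_def)

lemma DERIV_gauss_deriv: "(gauss_deriv l has_real_derivative gauss_deriv (Suc l) x) (at x)"
  unfolding gauss_deriv_def
  by (auto intro!: derivative_eq_intros simp: algebra_simps power2_eq_square)

text \<open>From \<open>(x\<^sup>2 / i) ^ i \<le> (1 + x\<^sup>2 / i) ^ i \<le> exp (x\<^sup>2)\<close>.\<close>

lemma power_exp_bounded: "\<bar>x\<bar> ^ i * exp (- (x\<^sup>2)) \<le> 1 + real i ^ i" for x :: real
proof -
  have "\<bar>x\<bar> ^ i \<le> 1 + (x\<^sup>2) ^ i"
  proof (cases "\<bar>x\<bar> \<le> 1")
    case True
    then show ?thesis
      by (intro order_trans[OF power_le_one]) auto
  next
    case False
    then have "\<bar>x\<bar> ^ i * 1 \<le> \<bar>x\<bar> ^ i * \<bar>x\<bar> ^ i"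
      by (intro mult_left_mono one_le_power) auto
    also have "\<dots> = (x\<^sup>2) ^ i"
      by (simp add: power_mult_distrib[symmetric] power2_eq_square flip: abs_mult)
    finally show ?thesis by simp
  qed
  also have "\<dots> \<le> exp (x\<^sup>2) + real i ^ i * exp (x\<^sup>2)"
  proof (intro add_mono)
    show "(x\<^sup>2) ^ i \<le> real i ^ i * exp (x\<^sup>2)"
    proof (cases "i = 0")
      case False
      have "(x\<^sup>2 / real i) ^ i \<le> (1 + x\<^sup>2 / real i) ^ i"
        by (intro power_mono) auto
      also have "\<dots> \<le> exp (x\<^sup>2)"
        using False by (intro exp_ge_one_plus_x_over_n_power_n) (auto intro: order_trans[of _ 0])
      finally show ?thesis
        using False by (simp add: power_divide field_simps)
    qed auto
  qed auto
  finally have "\<bar>x\<bar> ^ i * exp (- (x\<^sup>2)) \<le> (exp (x\<^sup>2) + real i ^ i * exp (x\<^sup>2)) * exp (- (x\<^sup>2))"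
    by (intro mult_right_mono) auto
  also have "\<dots> = 1 + real i ^ i"
    by (simp add: algebra_simps flip: exp_add)
  finally show ?thesis .
qed

lemma gauss_deriv_bounded: "\<exists>B. \<forall>x. \<bar>gauss_deriv l x\<bar> \<le> B"
proof (intro exI allI)
  let ?p = "gauss_poly l"
  fix x
  have "\<bar>gauss_deriv l x\<bar> = \<bar>\<Sum>i\<le>degree ?p. coeff ?p i * x ^ i\<bar> * exp (- (x\<^sup>2))"
    by (simp add: gauss_deriv_def abs_mult poly_altdef)
  also have "\<dots> \<le> (\<Sum>i\<le>degree ?p. \<bar>coeff ?p i * x ^ i\<bar>) * exp (- (x\<^sup>2))"
    by (intro mult_right_mono sum_abs) auto
  also have "\<dots> = (\<Sum>i\<le>degree ?p. \<bar>coeff ?p i\<bar> * (\<bar>x\<bar> ^ i * exp (- (x\<^sup>2))))"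
    by (simp add: sum_distrib_right abs_mult power_abs mult.assoc)
  also have "\<dots> \<le> (\<Sum>i\<le>degree ?p. \<bar>coeff ?p i\<bar> * (1 + real i ^ i))"
    by (intro sum_mono mult_left_mono power_exp_bounded) auto
  finally show "\<bar>gauss_deriv l x\<bar> \<le> (\<Sum>i\<le>degree ?p. \<bar>coeff ?p i\<bar> * (1 + real i ^ i))" .
qed

lemma gauss_derivs_bounded:
  obtains B where "B > 0" "\<And>l x. l \<le> k \<Longrightarrow> \<bar>gauss_deriv l x\<bar> \<le> B"
proof -
  obtain b where b: "\<And>l x. \<bar>gauss_deriv l x\<bar> \<le> b l"
    using gauss_deriv_bounded by metis
  have b0: "0 \<le> b l" for l
    using b[of l 0] by simp
  show ?thesis
  proof
    show "1 + (\<Sum>l\<le>k. b l) > 0"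
      using b0 by (intro add_pos_nonneg sum_nonneg) auto
    show "\<bar>gauss_deriv l x\<bar> \<le> 1 + (\<Sum>l\<le>k. b l)" if "l \<le> k" for l x
      using b[of l x] member_le_sum[of l "{..k}" b] b0 that by auto
  qed
qed

text \<open>The function is bounded by \<open>B\<close> and Lipschitz with constant \<open>B\<close>. The Lipschitz bound serves for
distances up to 1, the trivial bound \<open>2 * B\<close> beyond.\<close>

lemma gauss_deriv_holder:
  assumes B: "\<And>x. \<bar>gauss_deriv k x\<bar> \<le> B" "\<And>x. \<bar>gauss_deriv (Suc k) x\<bar> \<le> B"
    and s: "0 < s" "s \<le> 1"
  shows "\<bar>gauss_deriv k u - gauss_deriv k v\<bar> \<le> 2 * B * \<bar>u - v\<bar> powr s"
proof (cases "\<bar>u - v\<bar> \<le> 1")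
  case True
  have "B \<ge> 0" using B(1)[of 0] by simp
  have "norm (gauss_deriv k u - gauss_deriv k v) \<le> B * norm (u - v)"
    using B(2) by (intro field_differentiable_bound[of UNIV _ "gauss_deriv (Suc k)"]) (auto intro: DERIV_gauss_deriv)
  then have "\<bar>gauss_deriv k u - gauss_deriv k v\<bar> \<le> B * \<bar>u - v\<bar> powr 1"
    by simp
  also have "\<dots> \<le> B * \<bar>u - v\<bar> powr s"
    using True s \<open>B \<ge> 0\<close> by (intro mult_left_mono powr_mono') auto
  also have "\<dots> \<le> 2 * B * \<bar>u - v\<bar> powr s"
    using \<open>B \<ge> 0\<close> by (intro mult_right_mono) auto
  finally show ?thesis .
next
  case False
  have "B \<ge> 0" using B(1)[of 0] by simp
  have "\<bar>gauss_deriv k u - gauss_deriv k v\<bar> \<le> 2 * B * 1"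
    using B(1)[of u] B(1)[of v] by simp
  also have "\<dots> \<le> 2 * B * \<bar>u - v\<bar> powr s"
    using False s \<open>B \<ge> 0\<close> by (intro mult_left_mono ge_one_powr_ge_zero) auto
  finally show ?thesis .
qed

lemma strict_floor_bounds:
  assumes "\<beta> > 0"
  shows "real (strict_floor \<beta>) < \<beta>" "\<beta> \<le> real (strict_floor \<beta>) + 1"
proof -
  have bound: "\<forall>k::nat. real k < \<beta> \<longrightarrow> k \<le> nat \<lceil>\<beta>\<rceil>"
    using assms by (intro allI impI) linarith
  show "real (strict_floor \<beta>) < \<beta>"
    unfolding strict_floor_def
    by (rule GreatestI_nat[where P = "\<lambda>k. real k < \<beta>" and k = 0]) (use assms bound in simp, use bound in blast)
  show "\<beta> \<le> real (strict_floor \<beta>) + 1"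
  proof (rule ccontr)
    assume "\<not> ?thesis"
    then have "real (Suc (strict_floor \<beta>)) < \<beta>"
      by simp
    with bound have "Suc (strict_floor \<beta>) \<le> (GREATEST k::nat. real k < \<beta>)"
      by (intro Greatest_le_nat[where P = "\<lambda>k. real k < \<beta>"]) blast+
    then have "Suc (strict_floor \<beta>) \<le> strict_floor \<beta>"
      by (simp only: strict_floor_def)
    then show False by simp
  qed
qed

text \<open>The Gaussian profile is square integrable, which keeps the energy of order \<open>a\<^sup>2 * h\<close>, and has bounded
explicit derivatives of all orders, so that one profile serves every \<open>\<beta>\<close>.\<close>

definition bump :: "real \<Rightarrow> real \<Rightarrow> real \<Rightarrow> real \<Rightarrow> real" where
  "bump a h x\<^sub>0 x = a * exp (- ((x - x\<^sub>0) / h)\<^sup>2)"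

lemma deriv_within_bump:
  assumes "h > 0" "x \<in> {0..1}"
  shows "deriv_within {0..1} l (bump a h x\<^sub>0) x = a / h ^ l * gauss_deriv l ((x - x\<^sub>0) / h)"
    and "deriv_within {0..1} l (bump a h x\<^sub>0) differentiable (at x within {0..1})"
proof -
  let ?g = "\<lambda>l x. a / h ^ l * gauss_deriv l ((x - x\<^sub>0) / h)"
  have D: "(?g l has_real_derivative ?g (Suc l) x) (at x within {0..1})" for l x
    using assms(1) by (auto intro!: derivative_eq_intros DERIV_chain2[OF DERIV_gauss_deriv])
  have eq: "deriv_within {0..1} l (bump a h x\<^sub>0) x = ?g l x" if "x \<in> {0..1}" for l x
    using that
  proof (induction l arbitrary: x)
    case 0
    then show ?case by (simp add: deriv_within_def bump_def gauss_deriv_0)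
  next
    case (Suc l)
    have "(deriv_within {0..1} l (bump a h x\<^sub>0) has_vector_derivative ?g (Suc l) x) (at x within {0..1})"
      by (rule has_vector_derivative_transform[OF Suc.prems Suc.IH])
        (assumption, rule D[unfolded has_real_derivative_iff_has_vector_derivative])
    then have "vector_derivative (deriv_within {0..1} l (bump a h x\<^sub>0)) (at x within {0..1}) = ?g (Suc l) x"
      using Suc.prems by (intro vector_derivative_within_closed_interval) auto
    then show ?case
      by (simp add: deriv_within_def)
  qed
  show "deriv_within {0..1} l (bump a h x\<^sub>0) x = ?g l x"
    using assms(2) by (rule eq)
  have "(deriv_within {0..1} l (bump a h x\<^sub>0) has_real_derivative ?g (Suc l) x) (at x within {0..1})"
    by (rule has_field_derivative_transform_within[OF D zero_less_one assms(2)]) (rule eq[symmetric])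
  then show "deriv_within {0..1} l (bump a h x\<^sub>0) differentiable (at x within {0..1})"
    using real_differentiable_def by blast
qed

text \<open>Rescaling by \<open>h\<close> multiplies the \<open>l\<close>-th derivative by \<open>h powr (- l)\<close> and the Hoelder seminorm by
\<open>h powr (- \<beta>)\<close>. As \<open>h \<le> 1\<close>, the latter factor dominates all the others. There are
\<open>strict_floor \<beta> + 1\<close> derivatives, and the seminorm contributes the factor 2 of
\<open>gauss_deriv_holder\<close>.\<close>

lemma bump_in_holder_ball:
  assumes "\<beta> > 0" and h: "0 < h" "h \<le> 1" and "a \<ge> 0"
    and B: "\<And>l x. l \<le> Suc (strict_floor \<beta>) \<Longrightarrow> \<bar>gauss_deriv l x\<bar> \<le> B"
    and R: "(real (strict_floor \<beta>) + 3) * B * (a * h powr (- \<beta>)) \<le> R"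
  shows "bump a h x\<^sub>0 \<in> holder_ball \<beta> R"
proof -
  define k where "k = strict_floor \<beta>"
  define c where "c = B * (a * h powr (- \<beta>))"
  have k: "real k < \<beta>" "\<beta> \<le> real k + 1"
    using strict_floor_bounds[OF \<open>\<beta> > 0\<close>] by (auto simp: k_def)
  have "B \<ge> 0" using B[of 0 0] by simp
  then have "c \<ge> 0" using \<open>a \<ge> 0\<close> by (simp add: c_def)
  have derivs: "\<bar>deriv_within {0..1} l (bump a h x\<^sub>0) x\<bar> \<le> c" if "l \<le> k" "x \<in> {0..1}" for l x
  proof -
    have "\<bar>deriv_within {0..1} l (bump a h x\<^sub>0) x\<bar> = a * h powr (- real l) * \<bar>gauss_deriv l ((x - x\<^sub>0) / h)\<bar>"
      using h \<open>a \<ge> 0\<close> that by (simp add: deriv_within_bump abs_mult powr_minus powr_realpow divide_inverse)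
    also have "\<dots> \<le> a * h powr (- \<beta>) * B"
      using h \<open>a \<ge> 0\<close> \<open>B \<ge> 0\<close> that k B[of l] unfolding k_def[symmetric]
      by (intro mult_mono powr_mono') auto
    finally show ?thesis by (simp add: c_def mult_ac)
  qed
  have holder: "\<bar>deriv_within {0..1} k (bump a h x\<^sub>0) x - deriv_within {0..1} k (bump a h x\<^sub>0) y\<bar>
      / \<bar>x - y\<bar> powr (\<beta> - real k) \<le> 2 * c" if "x \<in> {0..1}" "y \<in> {0..1}" "x \<noteq> y" for x y
  proof -
    let ?u = "(x - x\<^sub>0) / h" and ?v = "(y - x\<^sub>0) / h"
    have "\<bar>?u - ?v\<bar> powr (\<beta> - real k) = \<bar>x - y\<bar> powr (\<beta> - real k) * h powr (real k - \<beta>)"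
    proof -
      have "\<bar>?u - ?v\<bar> = \<bar>x - y\<bar> / h"
        using h by (simp add: diff_divide_distrib[symmetric])
      also have "\<dots> powr (\<beta> - real k) = \<bar>x - y\<bar> powr (\<beta> - real k) * h powr - (\<beta> - real k)"
        using h by (simp only: powr_divide powr_minus_divide) simp
      finally show ?thesis by simp
    qed
    then have 1: "\<bar>gauss_deriv k ?u - gauss_deriv k ?v\<bar>
        \<le> 2 * B * (\<bar>x - y\<bar> powr (\<beta> - real k) * h powr (real k - \<beta>))"
      using gauss_deriv_holder[of k B "\<beta> - real k" ?u ?v] B k by (auto simp: k_def)
    have "\<bar>deriv_within {0..1} k (bump a h x\<^sub>0) x - deriv_within {0..1} k (bump a h x\<^sub>0) y\<bar>
        = a * h powr (- real k) * \<bar>gauss_deriv k ?u - gauss_deriv k ?v\<bar>"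
      using h \<open>a \<ge> 0\<close> that
      by (simp add: deriv_within_bump abs_mult powr_minus powr_realpow divide_inverse
          right_diff_distrib[symmetric])
    also have "\<dots> \<le> a * h powr (- real k) * (2 * B * (\<bar>x - y\<bar> powr (\<beta> - real k) * h powr (real k - \<beta>)))"
      using 1 \<open>a \<ge> 0\<close> by (intro mult_left_mono) auto
    also have "\<dots> = 2 * B * a * (h powr (- real k) * h powr (real k - \<beta>)) * \<bar>x - y\<bar> powr (\<beta> - real k)"
      by (simp add: mult_ac)
    also have "h powr (- real k) * h powr (real k - \<beta>) = h powr (- \<beta>)"
      by (simp flip: powr_add)
    finally show ?thesis
      using that by (simp add: divide_le_eq c_def mult_ac)
  qed
  have "holder_norm \<beta> {0..1} (bump a h x\<^sub>0) \<le> (\<Sum>l\<le>k. ennreal c) + ennreal (2 * c)"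
    unfolding holder_norm_def k_def[symmetric]
    using derivs holder by (intro add_mono sum_mono SUP_least) (auto intro!: ennreal_leI)
  also have "\<dots> = ennreal ((real k + 3) * c)"
    using \<open>c \<ge> 0\<close> by (simp add: ennreal_mult[symmetric] ennreal_of_nat_eq_real_of_nat ennreal_plus[symmetric] algebra_simps
      del: ennreal_plus)
  also have "\<dots> \<le> ennreal R"
    using R by (intro ennreal_leI) (simp add: c_def k_def mult_ac)
  finally show ?thesis
    using deriv_within_bump(2)[OF h(1)] by (auto simp: holder_ball_def differentiable_on_def)
qed

lemma continuous_on_bump: "h > 0 \<Longrightarrow> continuous_on S (bump a h x\<^sub>0)"
  unfolding bump_def by (intro continuous_intros) auto

text \<open>This is the Cauchy-Schwarz inequality on \<open>[s,t]\<close> combined with the pointwise estimate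
\<open>exp (- (u\<^sup>2))\<^sup>2 \<le> 1 / (1 + u\<^sup>2)\<close>, which makes the energy integral explicit through \<open>arctan\<close>. The
Cauchy-Schwarz part comes from integrating \<open>(f - m)\<^sup>2 \<ge> 0\<close> for the mean value \<open>m\<close> of \<open>f\<close>.\<close>

lemma bump_energy:
  assumes h: "h > 0" and st: "s < t"
  shows "(integral {s..t} (bump a h x\<^sub>0))\<^sup>2
    \<le> (t - s) * (a\<^sup>2 * h * arctan ((t - x\<^sub>0) / h) - a\<^sup>2 * h * arctan ((s - x\<^sub>0) / h))"
proof -
  let ?f = "bump a h x\<^sub>0" and ?I = "integral {s..t} (bump a h x\<^sub>0)"
  let ?G = "\<lambda>x. a\<^sup>2 * h * arctan ((x - x\<^sub>0) / h)" and ?g = "\<lambda>x. a\<^sup>2 / (1 + ((x - x\<^sub>0) / h)\<^sup>2)"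
  define m where "m = ?I / (t - s)"
  have I: "?I = m * (t - s)"
    using st by (simp add: m_def)
  have "(?G has_real_derivative ?g x) (at x within {s..t})" for x
    using h by (auto intro!: derivative_eq_intros simp: divide_inverse)
  then have G: "(?g has_integral ?G t - ?G s) {s..t}"
    using st by (intro fundamental_theorem_of_calculus)
      (auto simp: has_real_derivative_iff_has_vector_derivative[symmetric])
  have f: "(?f has_integral ?I) {s..t}"
    by (intro integrable_integral integrable_continuous_interval continuous_on_bump h)
  have lin: "((\<lambda>x. 2 * m * ?f x - m\<^sup>2) has_integral 2 * m * ?I - (t - s) * m\<^sup>2) {s..t}"
    using has_integral_diff[OF has_integral_mult_right[OF f, of "2 * m"] has_integral_const_real[of "m\<^sup>2" s t]] st
    by simp
  have "2 * m * ?I - (t - s) * m\<^sup>2 \<le> ?G t - ?G s"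
  proof (rule has_integral_le[OF lin G])
    fix x
    let ?u = "(x - x\<^sub>0) / h"
    have "0 \<le> (?f x - m)\<^sup>2" by simp
    then have "2 * m * ?f x - m\<^sup>2 \<le> (?f x)\<^sup>2"
      by (simp add: power2_diff algebra_simps)
    also have "(?f x)\<^sup>2 = a\<^sup>2 * (exp (- ?u\<^sup>2))\<^sup>2"
      by (simp add: bump_def power_mult_distrib)
    also have "(exp (- ?u\<^sup>2))\<^sup>2 \<le> exp (- ?u\<^sup>2)"
      by (simp add: power2_eq_square mult_left_le)
    also have "exp (- ?u\<^sup>2) \<le> 1 / (1 + ?u\<^sup>2)"
    proof -
      have "1 + ?u\<^sup>2 \<le> exp (?u\<^sup>2)" by (rule exp_ge_add_one_self)
      moreover have "1 + ?u\<^sup>2 > 0" by (simp add: add_pos_nonneg)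
      ultimately have "1 / exp (?u\<^sup>2) \<le> 1 / (1 + ?u\<^sup>2)" by (intro divide_left_mono) auto
      then show ?thesis by (simp add: exp_minus divide_inverse)
    qed
    finally show "2 * m * ?f x - m\<^sup>2 \<le> ?g x"
      by (simp add: mult_left_mono)
  qed
  moreover have "?I\<^sup>2 = (t - s) * (2 * m * ?I - (t - s) * m\<^sup>2)"
    unfolding I by (simp add: power2_eq_square algebra_simps)
  ultimately show ?thesis
    using st by (simp add: mult_left_mono)
qed

section \<open>The lower bound\<close>

text \<open>Let \<open>A\<close> be the event that \<open>T\<close> is at least the midpoint of \<open>p\<close> and \<open>p + \<Delta>\<close>. On \<open>A\<close> the distance
from \<open>T\<close> to \<open>p\<close> is at least \<open>\<Delta> / 2\<close>, off \<open>A\<close> the distance to \<open>q\<close> is. Domination excludes that \<open>A\<close>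
is unlikely under \<open>P\<close> while its complement is unlikely under \<open>Q\<close>: if \<open>P(A) < 1 / (4 * K)\<close>, then
\<open>Q(A) \<le> 1/4 + 1/4\<close>.\<close>

lemma two_point_testing:
  assumes P: "prob_space P" and Q: "prob_space Q" and sets_eq: "sets Q = sets P"
    and T: "T \<in> borel_measurable P" and K: "K \<ge> 1"
    and dom: "\<And>A. A \<in> sets P \<Longrightarrow> measure Q A \<le> 1/4 + K * measure P A"
    and sep: "p + \<Delta> \<le> q" and "\<Delta> \<ge> 0"
  shows "ennreal (\<Delta> / (8 * K)) \<le> max (mean_abs_dev P T p) (mean_abs_dev Q T q)"
proof -
  interpret P: prob_space P by fact
  interpret Q: prob_space Q by fact
  note T [measurable]
  have T' [measurable]: "T \<in> borel_measurable Q"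
    using T by (simp add: measurable_cong_sets[OF sets_eq refl])
  have space_eq: "space Q = space P"
    using sets_eq by (rule sets_eq_imp_space_eq)
  have dev: "ennreal (\<Delta> / 2 * measure S A) \<le> mean_abs_dev S T m"
    if "finite_measure S" "A \<in> sets S" "\<And>y. y \<in> A \<Longrightarrow> \<Delta> / 2 \<le> \<bar>T y - m\<bar>" for S A m
  proof -
    interpret S: finite_measure S by fact
    have "ennreal (\<Delta> / 2 * measure S A) = (\<integral>\<^sup>+y. ennreal (\<Delta> / 2) * indicator A y \<partial>S)"
      by (simp only: nn_integral_cmult_indicator[OF that(2)] S.emeasure_eq_measure ennreal_mult''[OF measure_nonneg])
    also have "\<dots> \<le> mean_abs_dev S T m"
      unfolding mean_abs_dev_def using that(3)
      by (intro nn_integral_mono) (auto simp: indicator_def intro!: ennreal_leI)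
    finally show ?thesis .
  qed
  define A where "A = {y \<in> space P. T y \<ge> p + \<Delta> / 2}"
  have A [measurable]: "A \<in> sets P"
    unfolding A_def by measurable
  show ?thesis
  proof (cases "measure P A \<ge> 1 / (4 * K)")
    case True
    have "\<Delta> / (8 * K) = \<Delta> / 2 * (1 / (4 * K))" by simp
    also have "\<dots> \<le> \<Delta> / 2 * measure P A"
      using True \<open>\<Delta> \<ge> 0\<close> by (intro mult_left_mono) auto
    finally have "ennreal (\<Delta> / (8 * K)) \<le> ennreal (\<Delta> / 2 * measure P A)"
      by (rule ennreal_leI)
    also have "\<dots> \<le> mean_abs_dev P T p"
    proof (rule dev[OF P.finite_measure_axioms A])
      show "\<Delta> / 2 \<le> \<bar>T y - p\<bar>" if "y \<in> A" for y
        using that unfolding A_def mem_Collect_eq by linarith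
    qed
    finally show ?thesis by (simp add: le_max_iff_disj)
  next
    case False
    have "K * measure P A \<le> K * (1 / (4 * K))"
      using False K by (intro mult_left_mono) auto
    then have "measure Q A \<le> 1/2"
      using dom[OF A] K by simp
    then have "1/2 \<le> measure Q (space Q - A)"
      using A sets_eq by (simp add: Q.prob_compl)
    then have "\<Delta> / 2 * (1 / 2) \<le> \<Delta> / 2 * measure Q (space Q - A)"
      using \<open>\<Delta> \<ge> 0\<close> by (intro mult_left_mono) auto
    moreover have "\<Delta> / (8 * K) \<le> \<Delta> / 2 * (1 / 2)"
      using divide_left_mono[of 4 "8 * K" \<Delta>] \<open>\<Delta> \<ge> 0\<close> K by simp
    ultimately have "ennreal (\<Delta> / (8 * K)) \<le> ennreal (\<Delta> / 2 * measure Q (space Q - A))"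
      by (intro ennreal_leI) simp
    also have "\<dots> \<le> mean_abs_dev Q T q"
    proof (rule dev[OF Q.finite_measure_axioms])
      show "space Q - A \<in> sets Q"
        using A unfolding sets_eq[symmetric] by (rule sets.compl_sets)
      show "\<Delta> / 2 \<le> \<bar>T y - q\<bar>" if "y \<in> space Q - A" for y
        using that sep unfolding A_def space_eq Diff_iff mem_Collect_eq by linarith
    qed
    finally show ?thesis by (simp add: le_max_iff_disj)
  qed
qed

lemma prob_space_data_law:
  assumes "standard_brownian_motion M W" "continuous_on {0..1} f"
  shows "prob_space (data_law M W n f)"
  unfolding data_law_def
  using brownian_motion_props(1)[OF assms(1)] measurable_observation[OF assms]
  by (rule prob_space.prob_space_distr)

text \<open>The function \<open>arctan\<close> has total variation \<open>\<pi>\<close>, so the energy of a bump is at most \<open>a\<^sup>2 * h * \<pi>\<close>,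
wherever it is centred.\<close>

lemma bump_domination:
  assumes W: "standard_brownian_motion M W" and "n > 0" and h: "h > 0"
    and E: "real n * (a\<^sup>2 * h * pi) \<le> E" and A: "A \<in> sets path_space"
  shows "measure (data_law M W n (bump a h x\<^sub>0)) A \<le> 1/4 + exp E * measure (data_law M W n (\<lambda>_. 0)) A"
proof (rule data_law_domination[OF W \<open>n > 0\<close> continuous_on_bump[OF h] _ _ A])
  let ?f = "bump a h x\<^sub>0" and ?G = "\<lambda>x. a\<^sup>2 * h * arctan ((x - x\<^sub>0) / h)"
  have f: "continuous_on S ?f" for S
    by (rule continuous_on_bump[OF h])
  show "(signal_integral ?f t - signal_integral ?f s)\<^sup>2 \<le> (t - s) * (?G t - ?G s)"
    if "0 \<le> s" "s < t" "t \<le> 1" for s t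
  proof -
    have "integral {0..s} ?f + integral {s..t} ?f = integral {0..t} ?f"
      using that by (intro Henstock_Kurzweil_Integration.integral_combine integrable_continuous_interval f) auto
    then have "signal_integral ?f t - signal_integral ?f s = integral {s..t} ?f"
      using that by (simp add: signal_integral_eq[OF f])
    then show ?thesis
      using bump_energy[OF h \<open>s < t\<close>] by simp
  qed
  have "arctan ((1 - x\<^sub>0) / h) - arctan ((0 - x\<^sub>0) / h) \<le> pi"
    using arctan_bounded[of "(1 - x\<^sub>0) / h"] arctan_bounded[of "(0 - x\<^sub>0) / h"] by linarith
  then have "a\<^sup>2 * h * (arctan ((1 - x\<^sub>0) / h) - arctan ((0 - x\<^sub>0) / h)) \<le> a\<^sup>2 * h * pi"
    using h by (intro mult_left_mono) auto
  then have "real n * (?G 1 - ?G 0) \<le> real n * (a\<^sup>2 * h * pi)"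
    by (intro mult_left_mono) (simp_all add: right_diff_distrib)
  with E show "real n * (?G 1 - ?G 0) \<le> E"
    by simp
qed

text \<open>With amplitude of the order \<open>(C / n) powr \<gamma>\<close>, the bandwidth \<open>h\<close> of order \<open>n powr (- 1 / (2 * \<beta> + 1))\<close>
is the one for which neither the Hoelder bound of a bump nor \<open>n\<close> times its energy bound depends on \<open>n\<close>.\<close>

lemma bump_scaling:
  fixes \<beta> C \<rho> x :: real
  assumes "\<beta> > 0" "C > 0" "\<rho> > 0" "x > 0"
  defines "\<gamma> \<equiv> \<beta> / (2 * \<beta> + 1)" and "h \<equiv> \<rho> * x powr (- (1 / (2 * \<beta> + 1)))"
  shows "(C / x) powr \<gamma> * h powr (- \<beta>) = C powr \<gamma> * \<rho> powr (- \<beta>)"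
    and "x * (((C / x) powr \<gamma>)\<^sup>2 * h) = (C powr \<gamma>)\<^sup>2 * \<rho>"
proof -
  have d: "(C / x) powr \<gamma> = C powr \<gamma> * x powr (- \<gamma>)"
    using \<open>C > 0\<close> \<open>x > 0\<close> by (simp add: powr_divide powr_minus_divide)
  have hb: "h powr (- \<beta>) = \<rho> powr (- \<beta>) * x powr \<gamma>"
    using assms by (simp add: h_def \<gamma>_def powr_mult powr_powr)
  have "x powr (- \<gamma>) * x powr \<gamma> = 1"
    using \<open>x > 0\<close> by (simp flip: powr_add)
  then have "C powr \<gamma> * \<rho> powr (- \<beta>) = C powr \<gamma> * \<rho> powr (- \<beta>) * (x powr (- \<gamma>) * x powr \<gamma>)"
    by simp
  then show "(C / x) powr \<gamma> * h powr (- \<beta>) = C powr \<gamma> * \<rho> powr (- \<beta>)"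
    unfolding d hb by (simp only: mult_ac)
  have "\<gamma> + \<gamma> + 1 / (2 * \<beta> + 1) = 1"
    unfolding \<gamma>_def add_divide_distrib[symmetric] using \<open>\<beta> > 0\<close> by simp
  then have "1 + (- \<gamma> + - \<gamma> + - (1 / (2 * \<beta> + 1))) = 0"
    by simp
  then have "x powr 1 * (x powr (- \<gamma>) * x powr (- \<gamma>) * x powr (- (1 / (2 * \<beta> + 1)))) = 1"
    using assms by (simp only: powr_add[symmetric]) simp
  then have e: "x * (x powr (- \<gamma>) * (x powr (- \<gamma>) * x powr (- (1 / (2 * \<beta> + 1))))) = 1"
    using assms by (simp add: mult.assoc)
  have "x * (((C / x) powr \<gamma>)\<^sup>2 * h) = (C powr \<gamma>)\<^sup>2 * \<rho> *
      (x * (x powr (- \<gamma>) * (x powr (- \<gamma>) * x powr (- (1 / (2 * \<beta> + 1))))))"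
    by (simp only: d h_def power2_eq_square mult_ac)
  then show "x * (((C / x) powr \<gamma>)\<^sup>2 * h) = (C powr \<gamma>)\<^sup>2 * \<rho>"
    unfolding e by simp
qed

text \<open>The centre \<open>m f\<close> may be any functional of \<open>f\<close> that is uniformly close to \<open>f x\<^sub>0\<close>; means and medians
are two instances. The alternative to the zero signal is a bump of height \<open>3 * b\<close> at \<open>x\<^sub>0\<close>, where
\<open>b = (C / n) powr \<gamma>\<close> bounds the error of the centres: each centre may be off by \<open>b\<close>, which leaves a
separation of at least \<open>b\<close>.\<close>

lemma deviation_lower_bound:
  fixes \<beta> R C :: real
  assumes \<beta>: "\<beta> > 0" and R: "R > 0" and C: "C > 0"
  obtains c N where "c > 0" "N > 0"
    "\<And>x\<^sub>0 (M :: 'w measure) W n T m. \<lbrakk>standard_brownian_motion M W; n \<ge> N; estimator T;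
        (SUP f\<in>holder_ball \<beta> R. ennreal \<bar>m f - f x\<^sub>0\<bar>) < ennreal ((C / real n) powr (\<beta> / (2 * \<beta> + 1)))\<rbrakk>
      \<Longrightarrow> ennreal (c * real n powr (- \<beta> / (2 * \<beta> + 1)))
        \<le> (SUP f\<in>holder_ball \<beta> R. mean_abs_dev (data_law M W n f) T (m f))"
proof -
  define \<gamma> where "\<gamma> = \<beta> / (2 * \<beta> + 1)"
  define k where "k = strict_floor \<beta>"
  obtain B where B: "B > 0" "\<And>l x. l \<le> Suc k \<Longrightarrow> \<bar>gauss_deriv l x\<bar> \<le> B"
    using gauss_derivs_bounded[where k = "Suc k"] by metis
  define S where "S = (real k + 3) * B * (3 * C powr \<gamma>)"
  have "S > 0" using B C by (simp add: S_def)
  \<comment> \<open>This makes the Hoelder bound for the bump of height \<open>3 * b\<close> equal to \<open>R\<close>.\<close>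
  define \<rho> where "\<rho> = (S / R) powr (1 / \<beta>)"
  have "\<rho> > 0" using \<open>S > 0\<close> R by (simp add: \<rho>_def)
  have S\<rho>: "S * \<rho> powr (- \<beta>) = R"
    using \<open>S > 0\<close> R \<beta> by (simp add: \<rho>_def powr_powr powr_minus)
  \<comment> \<open>\<open>E\<close> is \<open>n\<close> times the energy bound of that bump, and \<open>N\<close> ensures \<open>h \<le> 1\<close>.\<close>
  define E where "E = 9 * (C powr \<gamma>)\<^sup>2 * \<rho> * pi"
  define K where "K = exp E"
  have K: "K \<ge> 1" using \<open>\<rho> > 0\<close> by (simp add: K_def E_def)
  define c where "c = C powr \<gamma> / (8 * K)"
  define N where "N = Suc (nat \<lceil>\<rho> powr (2 * \<beta> + 1)\<rceil>)"
  have main: "ennreal (c * real n powr (- \<gamma>)) \<le> (SUP f\<in>holder_ball \<beta> R. mean_abs_dev (data_law M W n f) T (m f))"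
    if W: "standard_brownian_motion M W" and n: "n \<ge> N" and T: "estimator T"
      and m: "(SUP f\<in>holder_ball \<beta> R. ennreal \<bar>m f - f x\<^sub>0\<bar>) < ennreal ((C / real n) powr \<gamma>)"
    for x\<^sub>0 and M :: "'w measure" and W n T and m :: "(real \<Rightarrow> real) \<Rightarrow> real"
  proof -
    define b where "b = (C / real n) powr \<gamma>"
    define h where "h = \<rho> * real n powr (- (1 / (2 * \<beta> + 1)))"
    have "n > 0" using n by (simp add: N_def)
    then have h: "h > 0" using \<open>\<rho> > 0\<close> by (simp add: h_def)
    have "b > 0" using C \<open>n > 0\<close> by (simp add: b_def)
    have "\<rho> powr (2 * \<beta> + 1) \<le> real n"
      using n unfolding N_def by linarith
    then have "(\<rho> powr (2 * \<beta> + 1)) powr (1 / (2 * \<beta> + 1)) \<le> real n powr (1 / (2 * \<beta> + 1))"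
      using \<beta> by (intro powr_mono2) auto
    then have "\<rho> \<le> real n powr (1 / (2 * \<beta> + 1))"
      using \<beta> \<open>\<rho> > 0\<close> by (simp add: powr_powr)
    then have "h \<le> 1"
      using \<open>n > 0\<close> by (simp add: h_def powr_minus divide_inverse[symmetric] divide_le_eq)
    have scale: "b * h powr (- \<beta>) = C powr \<gamma> * \<rho> powr (- \<beta>)" "real n * (b\<^sup>2 * h) = (C powr \<gamma>)\<^sup>2 * \<rho>"
      using bump_scaling[OF \<beta> C \<open>\<rho> > 0\<close>, of "real n"] \<open>n > 0\<close> by (simp_all add: b_def h_def \<gamma>_def)
    have in_ball: "bump a h x\<^sub>0 \<in> holder_ball \<beta> R" if "0 \<le> a" "a \<le> 3 * b" for a
    proof (rule bump_in_holder_ball[OF \<beta> h \<open>h \<le> 1\<close> \<open>0 \<le> a\<close>])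
      show "\<bar>gauss_deriv l x\<bar> \<le> B" if "l \<le> Suc (strict_floor \<beta>)" for l x
        using B(2) that by (simp add: k_def)
      have "(real k + 3) * B * (a * h powr (- \<beta>)) \<le> (real k + 3) * B * (3 * b * h powr (- \<beta>))"
        using that B(1) by (intro mult_left_mono mult_right_mono) auto
      also have "\<dots> = S * \<rho> powr (- \<beta>)"
        using scale(1) by (simp add: S_def mult_ac)
      finally show "(real (strict_floor \<beta>) + 3) * B * (a * h powr (- \<beta>)) \<le> R"
        by (simp add: S\<rho> k_def)
    qed
    define f where "f = bump (3 * b) h x\<^sub>0"
    have f_ball: "f \<in> holder_ball \<beta> R" and f_x0: "f x\<^sub>0 = 3 * b"
      unfolding f_def using \<open>b > 0\<close> by (auto intro!: in_ball simp: bump_def)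
    have "bump 0 h x\<^sub>0 = (\<lambda>_. 0)"
      by (simp add: bump_def fun_eq_iff)
    then have zero: "(\<lambda>_. 0) \<in> holder_ball \<beta> R"
      using in_ball[of 0] \<open>b > 0\<close> by simp
    have close: "\<bar>m g - g x\<^sub>0\<bar> < b" if "g \<in> holder_ball \<beta> R" for g
    proof -
      have "ennreal \<bar>m g - g x\<^sub>0\<bar> < ennreal b"
        using SUP_upper[OF that, of "\<lambda>f. ennreal \<bar>m f - f x\<^sub>0\<bar>"] m unfolding b_def by (rule le_less_trans)
      then show ?thesis
        by (simp add: ennreal_less_iff)
    qed
    have sep: "m (\<lambda>_. 0) + b \<le> m f"
      using close[OF zero] close[OF f_ball] f_x0 by simp
    have laws: "prob_space (data_law M W n (\<lambda>_. 0))" "prob_space (data_law M W n f)"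
      unfolding f_def by (intro prob_space_data_law[OF W] continuous_on_const continuous_on_bump[OF h])+
    have "real n * ((3 * b)\<^sup>2 * h * pi) = 9 * (real n * (b\<^sup>2 * h)) * pi"
      by (simp add: power2_eq_square)
    also have "\<dots> = E"
      unfolding scale(2) by (simp add: E_def)
    finally have dom: "measure (data_law M W n f) A \<le> 1/4 + K * measure (data_law M W n (\<lambda>_. 0)) A"
      if "A \<in> sets (data_law M W n (\<lambda>_. 0))" for A
      unfolding f_def K_def using that by (intro bump_domination[OF W \<open>n > 0\<close> h]) (auto simp: data_law_def)
    have "b / (8 * K) = c * real n powr (- \<gamma>)"
      using C \<open>n > 0\<close> by (simp add: b_def c_def powr_divide powr_minus_divide)
    then have "ennreal (c * real n powr (- \<gamma>)) = ennreal (b / (8 * K))"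
      by simp
    also have "\<dots> \<le> max (mean_abs_dev (data_law M W n (\<lambda>_. 0)) T (m (\<lambda>_. 0)))
        (mean_abs_dev (data_law M W n f) T (m f))"
      using T \<open>b > 0\<close> by (intro two_point_testing[OF laws _ _ K dom sep]) (auto simp: data_law_def)
    also have "\<dots> \<le> (SUP f\<in>holder_ball \<beta> R. mean_abs_dev (data_law M W n f) T (m f))"
      by (rule max.boundedI) (rule SUP_upper, fact)+
    finally show ?thesis .
  qed
  have "c > 0" using C K by (simp add: c_def)
  have "N > 0" by (simp add: N_def)
  have exponent: "- \<beta> / (2 * \<beta> + 1) = - \<gamma>"
    by (simp add: \<gamma>_def)
  show thesis
    by (rule that[OF \<open>c > 0\<close> \<open>N > 0\<close>], unfold exponent \<gamma>_def[symmetric], rule main)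
qed

theorem theorem4p1:
  fixes \<beta> R C :: real
  assumes "\<beta> > 0" and "R > 0" and "C > 0"
  shows
    "(\<exists>c>0. \<exists>N>0. \<forall>x\<^sub>0\<in>{0..1}. \<forall>(M :: 'w measure) W. standard_brownian_motion M W \<longrightarrow>
       (\<forall>n\<ge>N. \<forall>T. estimator T \<longrightarrow>
          (\<forall>f\<in>holder_ball \<beta> R. integrable (data_law M W n f) T) \<longrightarrow>
          (SUP f\<in>holder_ball \<beta> R. ennreal \<bar>bias (data_law M W n f) T (f x\<^sub>0)\<bar>)
            < ennreal ((C / real n) powr (\<beta> / (2 * \<beta> + 1))) \<longrightarrow>
          (SUP f\<in>holder_ball \<beta> R.
              mean_abs_dev (data_law M W n f) T (integral\<^sup>L (data_law M W n f) T))
            \<ge> ennreal (c * real n powr (- \<beta> / (2 * \<beta> + 1)))))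
     \<and>
     (\<exists>c>0. \<exists>N>0. \<forall>x\<^sub>0\<in>{0..1}. \<forall>(M :: 'w measure) W. standard_brownian_motion M W \<longrightarrow>
       (\<forall>n\<ge>N. \<forall>T. estimator T \<longrightarrow>
          (\<forall>Med. (\<forall>f\<in>holder_ball \<beta> R. is_median (data_law M W n f) T (Med f)) \<longrightarrow>
             (SUP f\<in>holder_ball \<beta> R. ennreal \<bar>Med f - f x\<^sub>0\<bar>)
               < ennreal ((C / real n) powr (\<beta> / (2 * \<beta> + 1))) \<longrightarrow>
             (SUP f\<in>holder_ball \<beta> R. mean_abs_dev (data_law M W n f) T (Med f))
               \<ge> ennreal (c * real n powr (- \<beta> / (2 * \<beta> + 1))))))"
proof (rule deviation_lower_bound[OF assms, where ?'w = 'w])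
  fix c and N :: nat
  assume c: "c > 0" "N > 0" and bound:
    "\<And>x\<^sub>0 (M :: 'w measure) W n T m. \<lbrakk>standard_brownian_motion M W; n \<ge> N; estimator T;
        (SUP f\<in>holder_ball \<beta> R. ennreal \<bar>m f - f x\<^sub>0\<bar>) < ennreal ((C / real n) powr (\<beta> / (2 * \<beta> + 1)))\<rbrakk>
      \<Longrightarrow> ennreal (c * real n powr (- \<beta> / (2 * \<beta> + 1)))
        \<le> (SUP f\<in>holder_ball \<beta> R. mean_abs_dev (data_law M W n f) T (m f))"
  show ?thesis
    unfolding bias_def
    by (intro conjI exI[of _ c] exI[of _ N] c ballI allI impI) (rule bound; assumption)+
qed

end
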